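(* On the complex Hopf fibration $S^{2n+1}$ (with the sub-Riemannian structure below), for every covector $(x,p)$ with $|p^h|=1$, the cut time of $(x,p)$ coincides with the first conjugate time of $(x,p)$.
   Context: Complex Hopf fibration: $S^{2n+1}=\{z\in\mathbb C^{n+1}:|z|=1\}$, $z_j=x_j+iy_j$, $\alpha_0=\frac12\sum_j(x_jdy_j-y_jdx_j)$, $v_0=2\sum_j(-y_j\partial_{x_j}+x_j\partial_{y_j})$; the Riemannian metric makes $v_0$ a unit vector orthogonal to $\ker\alpha_0$ and agrees with the Euclidean metric on $\ker\alpha_0$; $Jv_0=0$ and $J$ on $\ker\alpha_0$ is multiplication by $i$. Sub-Riemannian structure: $\mathcal D=\ker\alpha_0$ with the Euclidean metric. For $p\in T^*_xM$, $p^h\in\mathcal D_x$ is defined by $p(w)=\langle p^h,w\rangle$, $w\in\mathcal D_x$. Hamiltonian $H(x,p)=\frac12|p^h|^2$, $e^{t\vec H}$ its Hamiltonian flow, $\pi:T^*M\to M$, $\psi_t(x,p)=\pi(e^{t\vec H}(x,p))$. The cut time of $(x,p)$ is the supremum of $T>0$ such that $t\in[0,T]\mapsto\psi_t(x,p)$ is length minimizing for the sub-Riemannian distance between its endpoints. The first conjugate time is the smallest $t_0>0$ such that the differential at $p$ of $\psi_{t_0}(x,\cdot):T^*_xM\to M$ is not bijective. *)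

theory Defs
  imports "HOL-Analysis.Analysis"
begin

text \<open>Complex Hopf fibration.  C^{n+1} is modelled as complex^'m with CARD('m) = n+1;
  its real inner product and norm are the Euclidean ones of R^{2n+2}.
  S^{2n+1} is sphere 0 1.\<close>

definition hopf_dir :: "complex^'m \<Rightarrow> complex^'m" where
  "hopf_dir z = (\<chi> j. \<i> * z $ j)"   \<comment> \<open>i z, so that v0 = 2 (i z)\<close>

definition tspace :: "complex^'m \<Rightarrow> (complex^'m) set" where
  "tspace y = {v. inner v y = 0}"

text \<open>Horizontal distribution D = ker alpha0 (alpha0(w) = 1/2 <i z, w>).\<close>
definition hdist :: "complex^'m \<Rightarrow> (complex^'m) set" where
  "hdist z = {w. inner w z = 0 \<and> inner w (hopf_dir z) = 0}"

text \<open>p^h: for z on the sphere and a covector represented (via the Euclidean pairing)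
  by xi, p^h is the orthogonal projection of xi onto D_z. The formula is the smooth
  extension to z \<noteq> 0.\<close>
definition hproj :: "complex^'m \<Rightarrow> complex^'m \<Rightarrow> complex^'m" where
  "hproj z \<xi> = \<xi> - (inner \<xi> z / (norm z)\<^sup>2) *\<^sub>R z
                 - (inner \<xi> (hopf_dir z) / (norm z)\<^sup>2) *\<^sub>R hopf_dir z"

definition ham :: "complex^'m \<Rightarrow> complex^'m \<Rightarrow> real" where
  "ham z \<xi> = (norm (hproj z \<xi>))\<^sup>2 / 2"

definition ham_traj ::
  "complex^'m \<Rightarrow> complex^'m \<Rightarrow> (real \<Rightarrow> complex^'m) \<Rightarrow> (real \<Rightarrow> complex^'m) \<Rightarrow> bool" where
  "ham_traj z0 \<xi>0 zc \<xi>c \<longleftrightarrow> zc 0 = z0 \<and> \<xi>c 0 = \<xi>0 \<and>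
     (\<forall>t. \<exists>z' \<xi>'. (zc has_vector_derivative z') (at t) \<and> (\<xi>c has_vector_derivative \<xi>') (at t) \<and>
        ((\<lambda>y. ham y (\<xi>c t)) has_derivative (\<lambda>u. - inner \<xi>' u)) (at (zc t)) \<and>
        ((\<lambda>\<eta>. ham (zc t) \<eta>) has_derivative (\<lambda>v. inner z' v)) (at (\<xi>c t)))"

definition psi :: "real \<Rightarrow> complex^'m \<Rightarrow> complex^'m \<Rightarrow> complex^'m" where
  "psi t x p = (THE zc. \<exists>\<xi>c. ham_traj x p zc \<xi>c) t"

definition horizontal_curve :: "real \<Rightarrow> real \<Rightarrow> (real \<Rightarrow> complex^'m) \<Rightarrow> bool" where
  "horizontal_curve a b \<gamma> \<longleftrightarrow> a \<le> b \<and> \<gamma> ` {a..b} \<subseteq> sphere 0 1 \<and>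
     (\<exists>L. L-lipschitz_on {a..b} \<gamma>) \<and>
     (AE t in lebesgue. t \<in> {a..b} \<longrightarrow>
        \<gamma> differentiable (at t) \<and> vector_derivative \<gamma> (at t) \<in> hdist (\<gamma> t))"

definition curve_length :: "real \<Rightarrow> real \<Rightarrow> (real \<Rightarrow> complex^'m) \<Rightarrow> real" where
  "curve_length a b \<gamma> = integral {a..b} (\<lambda>t. norm (vector_derivative \<gamma> (at t)))"

definition sr_dist :: "complex^'m \<Rightarrow> complex^'m \<Rightarrow> real" where
  "sr_dist y1 y2 = Inf {curve_length 0 1 \<gamma> | \<gamma>. horizontal_curve 0 1 \<gamma> \<and> \<gamma> 0 = y1 \<and> \<gamma> 1 = y2}"

definition minimizing_upto :: "complex^'m \<Rightarrow> complex^'m \<Rightarrow> real \<Rightarrow> bool" where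
  "minimizing_upto x p T \<longleftrightarrow>
     curve_length 0 T (\<lambda>t. psi t x p) = sr_dist (psi 0 x p) (psi T x p)"

definition cut_time :: "complex^'m \<Rightarrow> complex^'m \<Rightarrow> ereal" where
  "cut_time x p = Sup {ereal T | T. T > 0 \<and> minimizing_upto x p T}"

text \<open>t is conjugate: the differential at p of q \<mapsto> psi_t(x,q) on T*_xM (represented by
  tspace x) into T_{psi_t(x,p)}M is not bijective.\<close>
definition conjugate_at :: "complex^'m \<Rightarrow> complex^'m \<Rightarrow> real \<Rightarrow> bool" where
  "conjugate_at x p t \<longleftrightarrow>
     (\<exists>f'. ((\<lambda>q. psi t x q) has_derivative f') (at p within tspace x) \<and>
           \<not> bij_betw f' (tspace x) (tspace (psi t x p)))"

definition first_conj_time :: "complex^'m \<Rightarrow> complex^'m \<Rightarrow> real \<Rightarrow> bool" where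
  "first_conj_time x p t0 \<longleftrightarrow> t0 > 0 \<and> conjugate_at x p t0 \<and>
     (\<forall>t. 0 < t \<and> t < t0 \<longrightarrow> \<not> conjugate_at x p t)"

end

(* With b = <p, ix> and omega = |p| = sqrt (1 + b^2), the geodesic is the great circle
   cos (omega t) x + sin (omega t) / omega p rotated by exp (- i b t) along the fibres. Both times are
   pi / omega.

   Before pi / omega the differential of the exponential map is injective because tau cos tau < sin tau
   on (0, pi); at pi / omega it kills i p^h.

   Minimality up to pi / omega: let gamma be a horizontal curve of length L and rotate it along the
   fibres by a total angle c, at a rate proportional to arc length. As gamma' is orthogonal to the
   fibres, the rotated curve has length sqrt (L^2 + c^2), which therefore bounds the spherical distance
   of its end points. If gamma ends at psi_T and c = b T, this distance is omega T, so
   L^2 + b^2 T^2 >= omega^2 T^2, that is L >= T.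

   After pi / omega: all geodesics from x with the same b return to the fibre of x at time pi / omega.
   Shortly before that time leave one of them, turn on an arc with constant distance to the fibre, and
   join the given geodesic shortly after it. The arc is shorter than the part that it replaces, and
   rotating the initial covector adjusts the end point. *)

theory Submission
  imports Defs "HOL-Real_Asymp.Real_Asymp"
begin

subsection \<open>The complex structure and the Hamiltonian\<close>

text \<open>Three features of the definitions shape the proof. \<open>psi\<close> is a definite
  description, so the explicit geodesic needs uniqueness of Hamiltonian trajectories; conservation
  laws reduce this to a linear equation. The competitors in \<open>sr_dist\<close> are merely
  Lipschitz and their speed is known only almost everywhere, which makes arc length itself an
  awkward phase. The phase is driven instead by a continuous positive function that is L^1-close to
  the speed. A factor r < 1 inside arccos makes the angle to x Lipschitz, so that it can be
  recovered from its derivative. \<open>minimizing_upto\<close> tests a single T, so the supremum is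
  known only once minimality fails at every T > pi / \<omega>. For this reason the detour is made
  close to the cusp and the rest of the geodesic is kept. It pays off because of orders of
  magnitude: within time e of the cusp the angle to be made up is about b e^3 / 3 while the distance
  to the fibre is about e, so the arc costs O(e^2) against a saving of 2 e.\<close>

lemma bounded_linear_hopf_dir: "bounded_linear hopf_dir"
proof (rule linear_conv_bounded_linear[THEN iffD1], rule linearI)
qed (auto simp: hopf_dir_def vec_eq_iff algebra_simps)

lemmas hopf_dir_add = linear_add [OF bounded_linear.linear [OF bounded_linear_hopf_dir]]
lemmas hopf_dir_diff = linear_diff [OF bounded_linear.linear [OF bounded_linear_hopf_dir]]
lemmas hopf_dir_scaleR = linear_scale [OF bounded_linear.linear [OF bounded_linear_hopf_dir]]
lemmas has_derivative_hopf_dir_linear = bounded_linear.has_derivative [OF bounded_linear_hopf_dir]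

lemma hopf_dir_hopf_dir [simp]: "hopf_dir (hopf_dir v) = - v"
  by (simp add: hopf_dir_def vec_eq_iff mult.assoc[symmetric])

lemma inner_hopf_dir_hopf_dir [simp]: "inner (hopf_dir v) (hopf_dir w) = inner v w"
  by (simp add: hopf_dir_def inner_vec_def inner_complex_def add.commute)

lemma inner_hopf_dir_left: "inner (hopf_dir v) w = - inner v (hopf_dir w)"
  by (simp add: hopf_dir_def inner_vec_def inner_complex_def sum_negf[symmetric])

lemma inner_hopf_dir_self [simp]: "inner v (hopf_dir v) = 0" "inner (hopf_dir v) v = 0"
  by (simp_all add: hopf_dir_def inner_vec_def inner_complex_def mult.commute)

lemma norm_hopf_dir [simp]: "norm (hopf_dir v) = norm v"
  by (simp add: norm_eq_sqrt_inner)

text \<open>Multiplication by \<open>exp (\<i> \<theta>)\<close>, expressed through the real structure only.\<close>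
definition rot :: "real \<Rightarrow> complex^'m \<Rightarrow> complex^'m" where
  "rot \<theta> v = cos \<theta> *\<^sub>R v + sin \<theta> *\<^sub>R hopf_dir v"

lemma bounded_linear_rot: "bounded_linear (rot \<theta>)"
  unfolding rot_def[abs_def]
  by (intro bounded_linear_add bounded_linear_scaleR_const bounded_linear_ident
      bounded_linear_const_scaleR bounded_linear_hopf_dir)

lemmas rot_add = linear_add [OF bounded_linear.linear [OF bounded_linear_rot]]
lemmas rot_diff = linear_diff [OF bounded_linear.linear [OF bounded_linear_rot]]
lemmas rot_scaleR = linear_scale [OF bounded_linear.linear [OF bounded_linear_rot]]
lemmas rot_minus = linear_neg [OF bounded_linear.linear [OF bounded_linear_rot]]
lemmas rot_zero = linear_0 [OF bounded_linear.linear [OF bounded_linear_rot]]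

lemma rot_0 [simp]: "rot 0 v = v"
  by (simp add: rot_def)

lemma rot_rot: "rot a (rot b v) = rot (a + b) v"
  by (simp add: rot_def cos_add sin_add hopf_dir_add hopf_dir_scaleR hopf_dir_diff algebra_simps)

lemma hopf_dir_rot: "hopf_dir (rot a v) = rot a (hopf_dir v)"
  by (simp add: rot_def hopf_dir_add hopf_dir_scaleR)

lemma inner_rot_left: "inner (rot a v) w = inner v (rot (- a) w)"
  by (simp add: rot_def inner_add_left inner_diff_right inner_hopf_dir_left)

lemma inner_rot_rot [simp]: "inner (rot a v) (rot a w) = inner v w"
  by (simp add: inner_rot_left rot_rot)

lemma norm_rot [simp]: "norm (rot a v) = norm v"
  by (simp add: norm_eq_sqrt_inner)

lemma rot_pi [simp]: "rot pi v = - v"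
  by (simp add: rot_def)

lemma has_derivative_rot:
  assumes "(\<theta> has_derivative \<theta>') (at s within S)" and "(y has_derivative y') (at s within S)"
  shows "((\<lambda>s. rot (\<theta> s) (y s)) has_derivative
     (\<lambda>u. rot (\<theta> s) (y' u + \<theta>' u *\<^sub>R hopf_dir (y s)))) (at s within S)"
  using assms unfolding rot_def
  apply -
  apply (rule has_derivative_eq_rhs)
   apply (rule derivative_intros has_derivative_hopf_dir_linear | assumption)+
  apply (rule ext)
  apply (simp add: hopf_dir_add hopf_dir_scaleR algebra_simps)
  done

lemma has_vector_derivative_rot:
  assumes "(\<theta> has_real_derivative \<theta>') (at s within S)" and "(y has_vector_derivative y') (at s within S)"
  shows "((\<lambda>s. rot (\<theta> s) (y s)) has_vector_derivative
     rot (\<theta> s) (y' + \<theta>' *\<^sub>R hopf_dir (y s))) (at s within S)"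
  using has_derivative_rot[OF assms(1)[unfolded has_field_derivative_def] assms(2)[unfolded has_vector_derivative_def]]
  unfolding has_vector_derivative_def
  by (rule has_derivative_eq_rhs) (simp add: fun_eq_iff algebra_simps rot_scaleR[symmetric])

section \<open>Horizontal projection and the two partial derivatives of the Hamiltonian\<close>

lemma hproj_unit: "norm z = 1 \<Longrightarrow> hproj z \<xi> = \<xi> - inner \<xi> z *\<^sub>R z - inner \<xi> (hopf_dir z) *\<^sub>R hopf_dir z"
  by (simp add: hproj_def)

lemma hproj_orth: "inner (hproj z \<xi>) z = 0" "inner (hproj z \<xi>) (hopf_dir z) = 0"
  if "z \<noteq> 0"
  using that by (simp_all add: hproj_def inner_diff_left power2_norm_eq_inner)

lemma hproj_orth_self: "inner (hproj z \<xi>) z = 0"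
  by (cases "z = 0") (simp_all add: hproj_orth)

lemma bounded_linear_hproj: "bounded_linear (hproj z)"
  unfolding hproj_def[abs_def] divide_inverse
  by (intro bounded_linear_sub bounded_linear_ident bounded_linear_scaleR_const
      bounded_linear_mult_const bounded_linear_inner_left)

text \<open>An orthogonal projection is self-adjoint and idempotent. At \<open>z = 0\<close>
  division by zero returns 0, so \<open>hproj 0\<close> is the identity and the formula
  persists.\<close>

lemma inner_hproj_hproj: "inner (hproj z \<xi>) (hproj z \<eta>) = inner (hproj z \<xi>) \<eta>"
proof (cases "z = 0")
  case True
  then show ?thesis by (simp add: hproj_def)
next
  case False
  then show ?thesis
    by (subst (2) hproj_def) (simp add: inner_diff_right hproj_orth)
qed

lemma ham_has_derivative_covector:
  "((\<lambda>\<eta>. ham z \<eta>) has_derivative (\<lambda>v. inner (hproj z \<xi>) v)) (at \<xi>)"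
proof -
  interpret bounded_linear "hproj z" by (rule bounded_linear_hproj)
  have h: "(hproj z has_derivative hproj z) (at \<xi>)"
    by (rule bounded_linear_imp_has_derivative) (rule bounded_linear_hproj)
  have eq: "(\<lambda>\<eta>. ham z \<eta>) = (\<lambda>\<eta>. inner (hproj z \<eta>) (hproj z \<eta>) / 2)"
    by (simp add: ham_def fun_eq_iff power2_norm_eq_inner)
  show ?thesis unfolding eq
    apply (rule has_derivative_eq_rhs)
     apply (rule derivative_intros has_derivative_inner h | simp)+
    apply (rule ext)
    subgoal for v
      using inner_hproj_hproj[of z \<xi> v] inner_commute[of "hproj z v" "hproj z \<xi>"] by simp
    done
qed

text \<open>Pythagoras. Here the base point enters only through scalar products, which makes
  differentiation in \<open>z\<close> mechanical; homogeneity of degree 0 in \<open>z\<close> is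
  visible as well.\<close>

lemma ham_eq: "ham z \<xi> = (inner \<xi> \<xi> - (inner \<xi> z)\<^sup>2 / inner z z - (inner \<xi> (hopf_dir z))\<^sup>2 / inner z z) / 2"
proof (cases "z = 0")
  case False
  have "inner (hproj z \<xi>) (hproj z \<xi>) = inner (hproj z \<xi>) \<xi>"
    by (rule inner_hproj_hproj)
  also have "\<dots> = inner \<xi> \<xi> - (inner \<xi> z)\<^sup>2 / inner z z - (inner \<xi> (hopf_dir z))\<^sup>2 / inner z z"
    unfolding hproj_def inner_diff_left inner_scaleR_left power2_norm_eq_inner
    by (simp add: power2_eq_square inner_commute)
  finally show ?thesis by (simp add: ham_def power2_norm_eq_inner)
qed (simp add: ham_def hproj_def power2_norm_eq_inner)

text \<open>The term with \<open>hopf_dir \<xi>\<close> gets its sign from skewness: the derivative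
  of \<open>inner \<xi> (hopf_dir z)\<close> along \<open>u\<close> is
  \<open>- inner (hopf_dir \<xi>) u\<close>. The multiple of \<open>z\<close> comes from the
  denominators \<open>inner z z\<close>.\<close>

lemma ham_has_derivative_base:
  assumes "norm z = 1"
  shows "((\<lambda>y. ham y \<xi>) has_derivative
    (\<lambda>u. - inner (inner \<xi> z *\<^sub>R \<xi> - inner \<xi> (hopf_dir z) *\<^sub>R hopf_dir \<xi>
        - ((inner \<xi> z)\<^sup>2 + (inner \<xi> (hopf_dir z))\<^sup>2) *\<^sub>R z) u)) (at z)"
proof -
  have z: "inner z z = 1" "z \<noteq> 0" using assms by (auto simp: power2_norm_eq_inner[symmetric])
  show ?thesis unfolding ham_eq[abs_def]
    apply (rule has_derivative_eq_rhs)
     apply (rule derivative_intros has_derivative_hopf_dir_linear | simp add: z)+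
    apply (rule ext)
    apply (simp add: z inner_diff_left inner_add_left inner_hopf_dir_left inner_commute[of _ z] power2_eq_square)
    apply (simp add: field_simps)
    done
qed

subsection \<open>The Hamiltonian flow\<close>

definition geo :: "complex^'m \<Rightarrow> complex^'m \<Rightarrow> real \<Rightarrow> complex^'m" where
  "geo x q t = rot (- (inner q (hopf_dir x) * t))
     (cos (norm q * t) *\<^sub>R x + (sin (norm q * t) / norm q) *\<^sub>R q)"

definition geo_vel :: "complex^'m \<Rightarrow> complex^'m \<Rightarrow> real \<Rightarrow> complex^'m" where
  "geo_vel x q t = rot (- (inner q (hopf_dir x) * t))
     ((cos (norm q * t) *\<^sub>R q - (norm q * sin (norm q * t)) *\<^sub>R x)
      - inner q (hopf_dir x) *\<^sub>R hopf_dir (cos (norm q * t) *\<^sub>R x + (sin (norm q * t) / norm q) *\<^sub>R q))"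

lemma geo_0 [simp]: "geo x q 0 = x"
  by (simp add: geo_def)

lemma great_circle_has_vector_derivative:
  "((\<lambda>t. cos (norm q * t) *\<^sub>R x + (sin (norm q * t) / norm q) *\<^sub>R q) has_vector_derivative
     cos (norm q * t) *\<^sub>R q - (norm q * sin (norm q * t)) *\<^sub>R x) (at t)"
  by (cases "q = 0") (auto intro!: derivative_eq_intros simp: has_vector_derivative_def fun_eq_iff algebra_simps)

lemma geo_has_vector_derivative: "(geo x q has_vector_derivative geo_vel x q t) (at t)"
proof -
  have "((\<lambda>t. - (inner q (hopf_dir x) * t)) has_real_derivative - inner q (hopf_dir x)) (at t)"
    by (auto intro!: derivative_eq_intros)
  from has_vector_derivative_rot[OF this great_circle_has_vector_derivative[where q=q and x=x]]
  show ?thesis unfolding geo_def[abs_def] geo_vel_def by simp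
qed

lemma geo_vel_0: "geo_vel x q 0 = q - inner q (hopf_dir x) *\<^sub>R hopf_dir x"
  by (simp add: geo_vel_def)

text \<open>The length of \<open>q\<close> and of its horizontal part is left free: the differential
  in \<open>conjugate_at\<close> compares \<open>p\<close> with all nearby covectors, so the flow
  must be known for each of them.\<close>

locale tangent_covector =
  fixes x q :: "complex^'m"
  assumes unit: "norm x = 1" and tangent: "inner q x = 0"
begin

lemma inner_x [simp]: "inner x x = 1" "inner x q = 0" "inner q x = 0" "x \<noteq> 0"
  using unit tangent by (auto simp: power2_norm_eq_inner[symmetric] inner_commute)

lemma hproj_eq: "hproj x q = q - inner q (hopf_dir x) *\<^sub>R hopf_dir x"
  by (simp add: hproj_unit unit)

lemma norm_hproj: "(norm (hproj x q))\<^sup>2 = (norm q)\<^sup>2 - (inner q (hopf_dir x))\<^sup>2"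
  by (simp add: power2_norm_eq_inner inner_hproj_hproj)
     (simp add: hproj_eq inner_diff_left inner_diff_right power2_eq_square inner_commute)

lemma norm_geo: "norm (geo x q t) = 1"
proof -
  have "inner (geo x q t) (geo x q t) = (cos (norm q * t))\<^sup>2 + (sin (norm q * t) / norm q)\<^sup>2 * (norm q)\<^sup>2"
    unfolding geo_def inner_rot_rot
    by (simp add: inner_add_left inner_add_right power2_norm_eq_inner) (simp add: power2_eq_square)
  also have "\<dots> = 1"
    by (cases "q = 0") (simp_all add: power_divide)
  finally show ?thesis by (simp add: norm_eq_sqrt_inner)
qed

text \<open>The velocity of the great circle has the same fibre component
  \<open>inner q (hopf_dir x)\<close> at all times, and rotating backwards at exactly this rate
  removes it.\<close>

lemma geo_vel_hdist: "geo_vel x q t \<in> hdist (geo x q t)"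
proof -
  let ?c = "cos (norm q * t)" and ?s = "sin (norm q * t)" and ?b = "inner q (hopf_dir x)"
  let ?y = "?c *\<^sub>R x + (?s / norm q) *\<^sub>R q"
  let ?y' = "?c *\<^sub>R q - (norm q * ?s) *\<^sub>R x"
  have qq: "inner q q = norm q * norm q" by (simp add: power2_eq_square flip: power2_norm_eq_inner)
  have b: "inner x (hopf_dir q) = - ?b" by (metis inner_hopf_dir_left inner_commute)
  have yy: "inner ?y ?y = 1"
    using norm_geo[of t] unfolding geo_def norm_rot by (simp add: norm_eq_1)
  have "inner ?y' ?y = 0"
    by (simp add: inner_add_left inner_add_right inner_diff_left inner_diff_right qq)
  moreover have "inner ?y' (hopf_dir ?y) = ?b"
  proof -
    have "inner ?y' (hopf_dir ?y) = ?b * (?c * ?c + norm q * ?s * (?s / norm q))"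
      by (simp add: hopf_dir_add hopf_dir_scaleR inner_add_left inner_add_right inner_diff_left inner_diff_right b algebra_simps)
    also have "\<dots> = ?b"
      by (cases "q = 0") (simp_all flip: power2_eq_square)
    finally show ?thesis .
  qed
  ultimately show ?thesis
    by (simp add: hdist_def geo_vel_def geo_def hopf_dir_rot inner_diff_left yy)
qed

lemma norm_geo_vel: "norm (geo_vel x q t) = norm (hproj x q)"
proof -
  let ?c = "cos (norm q * t)" and ?s = "sin (norm q * t)" and ?b = "inner q (hopf_dir x)"
  let ?y = "?c *\<^sub>R x + (?s / norm q) *\<^sub>R q"
  let ?y' = "?c *\<^sub>R q - (norm q * ?s) *\<^sub>R x"
  have qq: "inner q q = (norm q)\<^sup>2" by (simp flip: power2_norm_eq_inner)
  have orth: "inner (?y' - ?b *\<^sub>R hopf_dir ?y) (hopf_dir ?y) = 0"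
    using geo_vel_hdist[of t] by (simp add: hdist_def geo_vel_def geo_def hopf_dir_rot)
  have yy: "inner ?y ?y = 1"
    using norm_geo[of t] unfolding geo_def norm_rot by (simp add: norm_eq_1)
  have "inner (geo_vel x q t) (geo_vel x q t) = inner (?y' - ?b *\<^sub>R hopf_dir ?y) (?y' - ?b *\<^sub>R hopf_dir ?y)"
    by (simp add: geo_vel_def)
  also have "\<dots> = inner ?y' ?y' - ?b\<^sup>2"
    using orth yy by (simp add: inner_diff_left inner_diff_right inner_commute power2_eq_square)
  also have "inner ?y' ?y' = ?c * ?c * (norm q)\<^sup>2 + norm q * ?s * (norm q * ?s)"
    by (simp add: inner_diff_left inner_diff_right qq)
  also have "\<dots> = (norm q)\<^sup>2"
    using sin_cos_squared_add[of "norm q * t"] by algebra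
  finally have "inner (geo_vel x q t) (geo_vel x q t) = (norm (hproj x q))\<^sup>2"
    by (simp add: norm_hproj)
  then show ?thesis by (simp add: norm_eq_sqrt_inner[of "geo_vel x q t"])
qed

text \<open>Eliminating the covector from Hamilton's equations leaves the equation of a charged
  particle in a magnetic field. With \<open>b\<close> and the speed fixed it is linear with constant
  coefficients, and the uniqueness proof relies on that.\<close>

lemma geo_vel_has_vector_derivative:
  "(geo_vel x q has_vector_derivative
     (- (2 * inner q (hopf_dir x))) *\<^sub>R hopf_dir (geo_vel x q t) - (norm (hproj x q))\<^sup>2 *\<^sub>R geo x q t) (at t)"
proof -
  let ?c = "\<lambda>t. cos (norm q * t)" and ?s = "\<lambda>t. sin (norm q * t)" and ?b = "inner q (hopf_dir x)"
  let ?y = "\<lambda>t. ?c t *\<^sub>R x + (?s t / norm q) *\<^sub>R q"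
  let ?y' = "\<lambda>t. ?c t *\<^sub>R q - (norm q * ?s t) *\<^sub>R x"
  have t: "((\<lambda>t. - (?b * t)) has_real_derivative - ?b) (at t)"
    by (auto intro!: derivative_eq_intros)
  have 1: "(?y has_vector_derivative ?y' t) (at t)"
    by (rule great_circle_has_vector_derivative)
  have 2: "(?y' has_vector_derivative - (norm q)\<^sup>2 *\<^sub>R ?y t) (at t)"
    by (cases "q = 0")
      (auto intro!: derivative_eq_intros simp: has_vector_derivative_def fun_eq_iff algebra_simps power2_eq_square)
  have 3: "((\<lambda>t. ?y' t - ?b *\<^sub>R hopf_dir (?y t)) has_vector_derivative
      - (norm q)\<^sup>2 *\<^sub>R ?y t - ?b *\<^sub>R hopf_dir (?y' t)) (at t)"
    by (intro derivative_intros 2 1 bounded_linear.has_vector_derivative[OF bounded_linear_hopf_dir]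
        has_vector_derivative_diff bounded_linear.has_vector_derivative[OF bounded_linear_scaleR_right])
  have *: "(geo_vel x q has_vector_derivative rot (- (?b * t))
      (- (norm q)\<^sup>2 *\<^sub>R ?y t - ?b *\<^sub>R hopf_dir (?y' t)
        + (- ?b) *\<^sub>R hopf_dir (?y' t - ?b *\<^sub>R hopf_dir (?y t)))) (at t)"
    using has_vector_derivative_rot[OF t 3] unfolding geo_vel_def[abs_def] .
  have gen: "- n *\<^sub>R Y - b *\<^sub>R hopf_dir Y' + (- b) *\<^sub>R hopf_dir (Y' - b *\<^sub>R hopf_dir Y)
      = (- (2 * b)) *\<^sub>R hopf_dir (Y' - b *\<^sub>R hopf_dir Y) - (n - b\<^sup>2) *\<^sub>R Y" for n b and Y Y' :: "complex^'m"
    by (simp add: hopf_dir_diff hopf_dir_scaleR algebra_simps power2_eq_square scaleR_2[symmetric])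
  show ?thesis
    using * unfolding gen norm_hproj
    unfolding geo_vel_def geo_def hopf_dir_rot rot_scaleR[symmetric] rot_diff[symmetric] .
qed

text \<open>The summand linear in \<open>t\<close> is the component normal to the sphere. As
  \<open>ham\<close> is homogeneous of degree 0 in the base point, \<xi>' is orthogonal to z, so
  this component grows at the rate <\<xi>, z'>, the constant squared speed.\<close>

lemma ham_traj_geo:
  "ham_traj x q (geo x q) (\<lambda>t. geo_vel x q t + ((norm (hproj x q))\<^sup>2 * t) *\<^sub>R geo x q t
      + inner q (hopf_dir x) *\<^sub>R hopf_dir (geo x q t))"
proof -
  let ?b = "inner q (hopf_dir x)" and ?r2 = "(norm (hproj x q))\<^sup>2"
  let ?z = "geo x q" and ?h = "geo_vel x q"
  let ?\<xi> = "\<lambda>t. ?h t + (?r2 * t) *\<^sub>R ?z t + ?b *\<^sub>R hopf_dir (?z t)"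
  show ?thesis unfolding ham_traj_def
  proof (intro conjI allI)
    show "?\<xi> 0 = q" by (simp add: geo_vel_0)
    fix t
    have zz: "inner (?z t) (?z t) = 1" using norm_geo[of t] by (simp add: norm_eq_1)
    have h: "inner (?h t) (?z t) = 0" "inner (?h t) (hopf_dir (?z t)) = 0"
      using geo_vel_hdist[of t] by (auto simp: hdist_def)
    have a: "inner (?\<xi> t) (?z t) = ?r2 * t" "inner (?\<xi> t) (hopf_dir (?z t)) = ?b"
      by (simp_all add: inner_add_left h zz)
    let ?\<xi>' = "(?r2 * t) *\<^sub>R ?h t - ?b *\<^sub>R hopf_dir (?h t)"
    have "(?\<xi> has_vector_derivative ((- (2 * ?b)) *\<^sub>R hopf_dir (?h t) - ?r2 *\<^sub>R ?z t)
        + ((?r2 * t) *\<^sub>R ?h t + ?r2 *\<^sub>R ?z t) + ?b *\<^sub>R hopf_dir (?h t)) (at t)"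
      by (intro has_vector_derivative_add geo_vel_has_vector_derivative has_vector_derivative_scaleR
          geo_has_vector_derivative bounded_linear.has_vector_derivative[OF bounded_linear_hopf_dir]
          bounded_linear.has_vector_derivative[OF bounded_linear_scaleR_right])
        (auto intro!: derivative_eq_intros)
    then have d: "(?\<xi> has_vector_derivative ?\<xi>') (at t)"
      by (rule has_vector_derivative_eq_rhs) (simp add: vec_eq_iff scaleR_conv_of_real algebra_simps)
    have hp: "hproj (?z t) (?\<xi> t) = ?h t"
      by (simp add: hproj_unit[OF norm_geo] a)
    have "?\<xi>' = inner (?\<xi> t) (?z t) *\<^sub>R ?\<xi> t - inner (?\<xi> t) (hopf_dir (?z t)) *\<^sub>R hopf_dir (?\<xi> t)
        - ((inner (?\<xi> t) (?z t))\<^sup>2 + (inner (?\<xi> t) (hopf_dir (?z t)))\<^sup>2) *\<^sub>R ?z t"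
      unfolding a by (simp add: hopf_dir_add hopf_dir_scaleR algebra_simps power2_eq_square)
    then have base: "((\<lambda>y. ham y (?\<xi> t)) has_derivative (\<lambda>u. - inner ?\<xi>' u)) (at (?z t))"
      using ham_has_derivative_base[OF norm_geo[of t], where \<xi>="?\<xi> t"] by simp
    show "\<exists>z' \<xi>'. (?z has_vector_derivative z') (at t) \<and> (?\<xi> has_vector_derivative \<xi>') (at t) \<and>
        ((\<lambda>y. ham y (?\<xi> t)) has_derivative (\<lambda>u. - inner \<xi>' u)) (at (?z t)) \<and>
        ((\<lambda>\<eta>. ham (?z t) \<eta>) has_derivative (\<lambda>v. inner z' v)) (at (?\<xi> t))"
      using geo_has_vector_derivative[of x q t] d base ham_has_derivative_covector[of "?z t" "?\<xi> t"]
      unfolding hp by blast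
  qed simp
qed

lemma const_of_zero_deriv:
  fixes f :: "real \<Rightarrow> real"
  assumes "\<And>t. (f has_real_derivative 0) (at t)"
  shows "f t = f 0"
  using DERIV_isconst_all[of f t 0] assms by blast

text \<open>Conservation of |z|, of the momentum \<open>b\<close> of the Hopf action and of the
  speed shows that every trajectory solves the same linear equation as \<open>geo x q\<close>; an
  energy identity for the difference then finishes.\<close>

lemma ham_traj_unique:
  assumes "ham_traj x q z \<xi>"
  shows "z = geo x q"
proof
  fix t
  have z0: "z 0 = x" and \<xi>0: "\<xi> 0 = q" using assms by (auto simp: ham_traj_def)
  have "\<exists>z' \<xi>'. \<forall>t. (z has_vector_derivative z' t) (at t) \<and> (\<xi> has_vector_derivative \<xi>' t) (at t) \<and>
        ((\<lambda>y. ham y (\<xi> t)) has_derivative (\<lambda>u. - inner (\<xi>' t) u)) (at (z t)) \<and>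
        ((\<lambda>\<eta>. ham (z t) \<eta>) has_derivative (\<lambda>v. inner (z' t) v)) (at (\<xi> t))"
    using assms unfolding ham_traj_def by metis
  then obtain z' \<xi>' where dz': "\<And>t. (z has_vector_derivative z' t) (at t)"
    and d\<xi>': "\<And>t. (\<xi> has_vector_derivative \<xi>' t) (at t)"
    and base: "\<And>t. ((\<lambda>y. ham y (\<xi> t)) has_derivative (\<lambda>u. - inner (\<xi>' t) u)) (at (z t))"
    and cov: "\<And>t. ((\<lambda>\<eta>. ham (z t) \<eta>) has_derivative (\<lambda>v. inner (z' t) v)) (at (\<xi> t))"
    by blast
  let ?a = "\<lambda>t. inner (\<xi> t) (z t)" and ?b = "\<lambda>t. inner (\<xi> t) (hopf_dir (z t))"
  have z'_eq: "z' t = hproj (z t) (\<xi> t)" for t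
    using has_derivative_unique[OF cov ham_has_derivative_covector]
    by (metis (full_types) vector_eq_rdot inner_commute)
  have dz: "(z has_vector_derivative hproj (z t) (\<xi> t)) (at t)" for t
    using dz' z'_eq by simp
  have inner_deriv: "((\<lambda>t. inner (f t) (g t)) has_real_derivative inner (f t) g' + inner f' (g t)) (at t)"
    if "(f has_vector_derivative f') (at t)" "(g has_vector_derivative g') (at t)" for f g :: "real \<Rightarrow> complex^'m" and f' g' t
    using bounded_bilinear.has_vector_derivative[OF bounded_bilinear_inner that]
    by (simp add: has_real_derivative_iff_has_vector_derivative)
  \<comment> \<open>The derivative in the base point is available only on the unit sphere, so the
    sphere has to be shown invariant first; orthogonality of \<open>hproj z\<close> to
    \<open>z\<close> holds everywhere.\<close>
  have "((\<lambda>t. inner (z t) (z t)) has_real_derivative 0) (at t)" for t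
    using inner_deriv[OF dz dz, of t] inner_commute[of "z t" "hproj (z t) (\<xi> t)"]
    by (simp add: hproj_orth_self)
  from const_of_zero_deriv[OF this] have zz: "inner (z t) (z t) = 1" for t
    by (simp add: z0)
  then have nz: "norm (z t) = 1" for t by (simp add: norm_eq_1)
  define h where "h = (\<lambda>t. \<xi> t - ?a t *\<^sub>R z t - ?b t *\<^sub>R hopf_dir (z t))"
  have h_eq: "hproj (z t) (\<xi> t) = h t" for t by (simp add: h_def hproj_unit[OF nz])
  have dz: "(z has_vector_derivative h t) (at t)" for t using dz[of t] by (simp add: h_eq)
  have hz: "inner (h t) (z t) = 0" "inner (h t) (hopf_dir (z t)) = 0" for t
    by (simp_all add: h_def inner_diff_left zz)
  have \<xi>_eq: "\<xi> t = h t + ?a t *\<^sub>R z t + ?b t *\<^sub>R hopf_dir (z t)" for t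
    by (simp add: h_def)
  have "inner (\<xi>' t) u = inner (?a t *\<^sub>R \<xi> t - ?b t *\<^sub>R hopf_dir (\<xi> t) - ((?a t)\<^sup>2 + (?b t)\<^sup>2) *\<^sub>R z t) u" for t u
    using fun_cong[OF has_derivative_unique[OF base ham_has_derivative_base[OF nz]], of t u] by simp
  then have \<xi>'_eq: "\<xi>' t = ?a t *\<^sub>R \<xi> t - ?b t *\<^sub>R hopf_dir (\<xi> t) - ((?a t)\<^sup>2 + (?b t)\<^sup>2) *\<^sub>R z t" for t
    using vector_eq_rdot by blast
  have \<xi>'_eq2: "\<xi>' t = ?a t *\<^sub>R h t - ?b t *\<^sub>R hopf_dir (h t)" for t
  proof -
    have gen: "a *\<^sub>R (H + a *\<^sub>R Z + b *\<^sub>R hopf_dir Z) - b *\<^sub>R hopf_dir (H + a *\<^sub>R Z + b *\<^sub>R hopf_dir Z) - (a\<^sup>2 + b\<^sup>2) *\<^sub>R Z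
      = a *\<^sub>R H - b *\<^sub>R hopf_dir H" for a b and H Z :: "complex^'m"
      by (simp add: hopf_dir_add hopf_dir_scaleR algebra_simps power2_eq_square)
    show ?thesis
      using \<xi>'_eq[of t] gen[of "?a t" "h t" "z t" "?b t"] \<xi>_eq[of t] by metis
  qed
  have dJz: "((\<lambda>t. hopf_dir (z t)) has_vector_derivative hopf_dir (h t)) (at t)" for t
    by (rule bounded_linear.has_vector_derivative[OF bounded_linear_hopf_dir dz])
  have hJz: "inner (hopf_dir (h t)) (z t) = 0" "inner (hopf_dir (h t)) (hopf_dir (z t)) = 0"
     "inner (z t) (hopf_dir (h t)) = 0" "inner (z t) (h t) = 0" for t
    using hz[of t] by (metis inner_hopf_dir_left inner_hopf_dir_hopf_dir inner_commute neg_0_equal_iff_equal)+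
  have "inner (\<xi> t) (hopf_dir (h t)) = ?b t * inner (hopf_dir (z t)) (hopf_dir (h t))" for t
    by (subst (1) \<xi>_eq) (simp add: inner_add_left hJz)
  then have b': "(?b has_real_derivative 0) (at t)" for t
    using inner_deriv[OF d\<xi>' dJz, of t] by (simp add: \<xi>'_eq2 inner_diff_left hz hJz)
  from const_of_zero_deriv[OF b'] have b: "?b t = inner q (hopf_dir x)" for t
    by (simp add: \<xi>0 z0)
  define b where "b = inner q (hopf_dir x)"
  have \<xi>h: "inner (\<xi> t) (h t) = inner (h t) (h t)" for t
    by (subst (1) \<xi>_eq) (simp add: inner_add_left hJz inner_hopf_dir_left)
  have a': "(?a has_real_derivative inner (h t) (h t)) (at t)" for t
    using inner_deriv[OF d\<xi>' dz, of t] by (simp add: \<xi>'_eq2 inner_diff_left hz hJz \<xi>h)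
  have h_alt: "h = (\<lambda>t. \<xi> t - ?a t *\<^sub>R z t - b *\<^sub>R hopf_dir (z t))"
    unfolding h_def b b_def ..
  have "(h has_vector_derivative \<xi>' t - (?a t *\<^sub>R h t + inner (h t) (h t) *\<^sub>R z t) - b *\<^sub>R hopf_dir (h t)) (at t)" for t
    apply (subst h_alt)
    by (intro has_vector_derivative_diff has_vector_derivative_scaleR a' d\<xi>' dz dJz
          bounded_linear.has_vector_derivative[OF bounded_linear_scaleR_right])
  then have dh: "(h has_vector_derivative (- (2 * b)) *\<^sub>R hopf_dir (h t) - inner (h t) (h t) *\<^sub>R z t) (at t)" for t
    by (rule has_vector_derivative_eq_rhs)
       (simp add: \<xi>'_eq2 b b_def[symmetric] vec_eq_iff scaleR_conv_of_real algebra_simps)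
  have "((\<lambda>t. inner (h t) (h t)) has_real_derivative 0) (at t)" for t
    using inner_deriv[OF dh dh, of t] by (simp add: inner_diff_right inner_diff_left hJz hz)
  from const_of_zero_deriv[OF this]
  have hh: "inner (h t) (h t) = inner (h 0) (h 0)" for t .
  have h0: "h 0 = geo_vel x q 0" by (simp add: h_def z0 \<xi>0 geo_vel_0)
  define r where "r = (norm (hproj x q))\<^sup>2"
  have r: "inner (h t) (h t) = r" for t
    using hh[of t] norm_geo_vel[of 0] by (simp add: h0 r_def flip: power2_norm_eq_inner)
  let ?d = "\<lambda>t. z t - geo x q t" and ?e = "\<lambda>t. h t - geo_vel x q t"
  have d: "(?d has_vector_derivative ?e t) (at t)" for t
    by (intro has_vector_derivative_diff dz geo_has_vector_derivative)
  have "(?e has_vector_derivative ((- (2 * b)) *\<^sub>R hopf_dir (h t) - r *\<^sub>R z t) -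
      ((- (2 * b)) *\<^sub>R hopf_dir (geo_vel x q t) - r *\<^sub>R geo x q t)) (at t)" for t
    using dh geo_vel_has_vector_derivative unfolding r r_def[symmetric] b_def[symmetric]
    by (intro has_vector_derivative_diff)
  then have e: "(?e has_vector_derivative (- (2 * b)) *\<^sub>R hopf_dir (?e t) - r *\<^sub>R ?d t) (at t)" for t
    by (rule has_vector_derivative_eq_rhs) (simp add: hopf_dir_diff algebra_simps)
  \<comment> \<open>With d' = e and e' = -2 b i e - r d the skew term drops out and the mixed terms
    cancel. If \<open>r = 0\<close> this energy controls only \<open>?e\<close>, hence
    \<open>?d\<close> is treated below through d' = e = 0.\<close>
  have "((\<lambda>t. inner (?e t) (?e t) + r * inner (?d t) (?d t)) has_real_derivative 0) (at t)" for t
  proof -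
    have "((\<lambda>t. inner (?e t) (?e t) + r * inner (?d t) (?d t)) has_real_derivative
        (inner (?e t) ((- (2 * b)) *\<^sub>R hopf_dir (?e t) - r *\<^sub>R ?d t) + inner ((- (2 * b)) *\<^sub>R hopf_dir (?e t) - r *\<^sub>R ?d t) (?e t))
        + r * (inner (?d t) (?e t) + inner (?e t) (?d t))) (at t)"
      by (intro DERIV_add DERIV_cmult inner_deriv d e)
    moreover have "inner E ((- (2 * b)) *\<^sub>R hopf_dir E - r *\<^sub>R D) + inner ((- (2 * b)) *\<^sub>R hopf_dir E - r *\<^sub>R D) E
        + r * (inner D E + inner E D) = 0" for E D :: "complex^'m"
      by (simp add: inner_diff_left inner_diff_right inner_commute[of D E])
    ultimately show ?thesis by (rule DERIV_cong)
  qed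
  from const_of_zero_deriv[OF this]
  have en: "inner (?e t) (?e t) + r * inner (?d t) (?d t) = 0" for t
    by (simp add: h0 z0)
  have r0: "r \<ge> 0" by (simp add: r_def)
  have e0: "?e t = 0" for t
    using en[of t] r0 inner_ge_zero[of "?e t"] mult_nonneg_nonneg[OF r0 inner_ge_zero[of "?d t"]]
    by (metis add_nonneg_eq_0_iff inner_eq_zero_iff)
  have "(?d has_vector_derivative 0) (at t)" for t
    using d[of t] unfolding e0 .
  then have "?d t = ?d 0"
    using has_vector_derivative_zero_constant[of UNIV ?d]
    by (metis UNIV_I convex_UNIV)
  then show "z t = geo x q t" by (simp add: z0)
qed

lemma psi_eq_geo: "psi t x q = geo x q t"
proof -
  have "(THE zc. \<exists>\<xi>c. ham_traj x q zc \<xi>c) = geo x q"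
    using ham_traj_geo ham_traj_unique by (intro the_equality) blast+
  then show ?thesis by (simp add: psi_def)
qed

end

subsection \<open>Conjugate times\<close>

text \<open>The variation \<open>v\<close> is split along \<open>p\<close>. The part along
  \<open>p\<close> changes the angular speed and moves the end point along the unit tangent of the
  circle; the orthogonal part is scaled by the Jacobi factor sin(\<omega> t) / \<omega>.\<close>

definition great_circle_deriv :: "complex^'m \<Rightarrow> complex^'m \<Rightarrow> real \<Rightarrow> complex^'m \<Rightarrow> complex^'m" where
  "great_circle_deriv x p t v =
     (inner p v / norm p * t) *\<^sub>R ((cos (norm p * t) / norm p) *\<^sub>R p - sin (norm p * t) *\<^sub>R x)
     + (sin (norm p * t) / norm p) *\<^sub>R (v - (inner p v / (norm p)\<^sup>2) *\<^sub>R p)"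

definition geo_deriv :: "complex^'m \<Rightarrow> complex^'m \<Rightarrow> real \<Rightarrow> complex^'m \<Rightarrow> complex^'m" where
  "geo_deriv x p t v = rot (- (inner p (hopf_dir x) * t))
     (great_circle_deriv x p t v - (t * inner v (hopf_dir x)) *\<^sub>R
        hopf_dir (cos (norm p * t) *\<^sub>R x + (sin (norm p * t) / norm p) *\<^sub>R p))"

lemma great_circle_has_derivative:
  assumes "p \<noteq> 0"
  shows "((\<lambda>q. cos (norm q * t) *\<^sub>R x + (sin (norm q * t) / norm q) *\<^sub>R q) has_derivative
    great_circle_deriv x p t) (at p)"
proof -
  have N: "((\<lambda>q. norm q) has_derivative (\<lambda>v. inner p v / norm p)) (at p)"
    using has_derivative_norm[OF assms] by (simp add: sgn_div_norm inner_commute divide_inverse mult.commute)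
  have NT: "((\<lambda>q. norm q * t) has_derivative (\<lambda>v. inner p v / norm p * t)) (at p)"
    by (intro has_derivative_mult_left N)
  have c: "((\<lambda>q. cos (norm q * t)) has_derivative (\<lambda>v. inner p v / norm p * t * (- sin (norm p * t)))) (at p)"
    using DERIV_compose_FDERIV[OF DERIV_cos NT] .
  have s: "((\<lambda>q. sin (norm q * t)) has_derivative (\<lambda>v. inner p v / norm p * t * cos (norm p * t))) (at p)"
    using DERIV_compose_FDERIV[OF DERIV_sin NT] .
  have sd: "((\<lambda>q. sin (norm q * t) / norm q) has_derivative
     (\<lambda>v. (inner p v / norm p * t * cos (norm p * t) * norm p - sin (norm p * t) * (inner p v / norm p)) / (norm p * norm p))) (at p)"
    by (rule has_derivative_divide'[OF s N]) (use assms in simp)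
  have n: "norm p \<noteq> 0" using assms by simp
  show ?thesis
    apply (rule has_derivative_eq_rhs)
     apply (rule has_derivative_add has_derivative_scaleR c sd has_derivative_const has_derivative_ident)+
    apply (rule ext)
    apply (simp add: great_circle_deriv_def scaleR_diff_right scaleR_diff_left diff_divide_distrib n)
    apply (simp add: field_simps power2_eq_square)
    done
qed

lemma geo_has_derivative:
  assumes "p \<noteq> 0"
  shows "((\<lambda>q. geo x q t) has_derivative geo_deriv x p t) (at p)"
proof -
  have "((\<lambda>q. - (inner q (hopf_dir x) * t)) has_derivative (\<lambda>v. - (inner v (hopf_dir x) * t))) (at p)"
    by (intro derivative_intros)
  from has_derivative_rot[OF this great_circle_has_derivative[OF assms]]
  show ?thesis
    unfolding geo_def geo_deriv_def[abs_def] by (simp add: mult.commute)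
qed

text \<open>A derivative within a hyperplane is determined only on vectors of the hyperplane, as
  restriction to lines shows. This suffices to settle the existential quantifier over
  \<open>f'\<close> in \<open>conjugate_at\<close>.\<close>

lemma has_derivative_within_tspace_unique:
  assumes "(f has_derivative f') (at p within tspace x)" "(f has_derivative g') (at p within tspace x)"
    and "p \<in> tspace x" "v \<in> tspace x"
  shows "f' v = g' v"
proof -
  have line: "((\<lambda>s. p + s *\<^sub>R v) has_derivative (\<lambda>s. s *\<^sub>R v)) (at 0)"
    by (auto intro!: derivative_eq_intros)
  have sub: "range (\<lambda>s. p + s *\<^sub>R v) \<subseteq> tspace x"
    using assms(3,4) by (auto simp: tspace_def inner_add_left)
  have *: "((\<lambda>s. f (p + s *\<^sub>R v)) has_derivative (\<lambda>s. h (s *\<^sub>R v))) (at 0)"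
    if "(f has_derivative h) (at p within tspace x)" for h
    by (rule has_derivative_in_compose[OF line]) (use has_derivative_subset[OF that sub] in simp)
  from has_derivative_unique[OF *[OF assms(1)] *[OF assms(2)]]
  show ?thesis by (metis scaleR_one)
qed

text \<open>Both tangent spaces are hyperplanes of the same dimension, so a trivial kernel already
  gives surjectivity.\<close>

lemma bij_betw_tspace:
  fixes f :: "complex^'m \<Rightarrow> complex^'m"
  assumes "linear f" and inj: "\<And>v. v \<in> tspace x \<Longrightarrow> f v = 0 \<Longrightarrow> v = 0"
    and sub: "f ` tspace x \<subseteq> tspace y" and "x \<noteq> 0" "y \<noteq> 0"
  shows "bij_betw f (tspace x) (tspace y)"
proof -
  have ts: "tspace z = {v. inner z v = 0}" for z :: "complex^'m"
    by (simp add: tspace_def inner_commute)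
  have ss: "subspace (tspace z)" for z :: "complex^'m"
    unfolding ts by (rule subspace_hyperplane)
  have inj': "inj_on f (tspace x)"
  proof (rule inj_onI)
    fix u v assume "u \<in> tspace x" "v \<in> tspace x" "f u = f v"
    then have "u - v \<in> tspace x" "f (u - v) = 0"
      by (auto simp: linear_diff[OF \<open>linear f\<close>] subspace_diff[OF ss])
    then show "u = v" using inj[of "u - v"] by simp
  qed
  have "dim (f ` tspace x) = dim (tspace x)"
    by (rule dim_image_eq[OF \<open>linear f\<close>]) (simp add: inj' span_eq_iff[THEN iffD2, OF ss])
  also have "\<dots> = dim (tspace y)"
    unfolding ts using assms(4,5) by (simp add: dim_hyperplane)
  finally have "f ` tspace x = tspace y"
    by (intro subspace_dim_equal ss sub linear_subspace_image[OF \<open>linear f\<close>]) simp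
  then show ?thesis using inj' by (simp add: bij_betw_def)
qed

lemma sin_greater_mult_cos:
  fixes \<tau> :: real
  assumes "0 < \<tau>" "\<tau> < pi"
  shows "\<tau> * cos \<tau> < sin \<tau>"
proof -
  let ?f = "\<lambda>\<tau>. sin \<tau> - \<tau> * cos \<tau>"
  have "?f 0 < ?f \<tau>"
  proof (rule DERIV_pos_imp_increasing_open[OF assms(1)])
    fix s assume "0 < s" "s < \<tau>"
    then have "(?f has_real_derivative s * sin s) (at s)" "s * sin s > 0"
      using assms by (auto intro!: derivative_eq_intros mult_pos_pos sin_gt_zero)
    then show "\<exists>y. (?f has_real_derivative y) (at s) \<and> 0 < y" by blast
  qed (auto intro!: continuous_intros)
  then show ?thesis by simp
qed

section \<open>Unit-speed geodesics and their conjugate times\<close>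

locale unit_covector = tangent_covector x p for x p :: "complex^'m" +
  assumes unit_hproj: "norm (hproj x p) = 1"
begin

abbreviation "\<omega> \<equiv> norm p"
abbreviation "b \<equiv> inner p (hopf_dir x)"

lemma omega_sq: "\<omega>\<^sup>2 = 1 + b\<^sup>2"
  using norm_hproj unit_hproj by simp

lemma omega_pos: "0 < \<omega>"
proof -
  have "0 < \<omega>\<^sup>2" unfolding omega_sq by (rule add_pos_nonneg) simp_all
  then show ?thesis by simp
qed

lemma p_nonzero: "p \<noteq> 0"
  using omega_pos by auto

lemma inner_pp: "inner p p = \<omega> * \<omega>"
  by (simp add: power2_eq_square flip: power2_norm_eq_inner)

lemma conjugate_at_iff:
  "conjugate_at x p t \<longleftrightarrow> \<not> bij_betw (geo_deriv x p t) (tspace x) (tspace (geo x p t))"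
proof -
  have p: "p \<in> tspace x" by (simp add: tspace_def)
  have eq: "psi t x q = geo x q t" if "q \<in> tspace x" for q
  proof -
    interpret tangent_covector x q
      using that unit by unfold_locales (auto simp: tspace_def)
    show ?thesis by (rule psi_eq_geo)
  qed
  have d: "((\<lambda>q. psi t x q) has_derivative geo_deriv x p t) (at p within tspace x)"
    by (rule has_derivative_transform[OF p eq has_derivative_at_withinI[OF geo_has_derivative[OF p_nonzero]]])
  have "bij_betw f' (tspace x) (tspace (geo x p t)) \<longleftrightarrow> bij_betw (geo_deriv x p t) (tspace x) (tspace (geo x p t))"
    if "((\<lambda>q. psi t x q) has_derivative f') (at p within tspace x)" for f'
    by (rule bij_betw_cong) (rule has_derivative_within_tspace_unique[OF that d p])
  then show ?thesis
    unfolding conjugate_at_def eq[OF p] using d by blast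
qed

lemma linear_geo_deriv: "linear (geo_deriv x p t)"
  by (rule has_derivative_linear[OF geo_has_derivative[OF p_nonzero]])

text \<open>The vector i p^h is orthogonal to \<open>p\<close> and to \<open>hopf_dir x\<close>, so
  only the Jacobi term with factor sin(\<omega> t) / \<omega> acts on it.\<close>

lemma conjugate_at_pi: "conjugate_at x p (pi / \<omega>)"
proof -
  let ?v = "hopf_dir (hproj x p)"
  have v: "?v \<in> tspace x" "inner ?v (hopf_dir x) = 0"
    using hproj_orth[of x p] by (simp_all add: tspace_def inner_hopf_dir_left[of _ x])
  have pv: "inner p ?v = 0"
    by (simp add: hproj_eq hopf_dir_diff hopf_dir_scaleR inner_diff_right inner_add_right)
  have v0: "?v \<noteq> 0"
    using unit_hproj by (metis norm_eq_zero norm_hopf_dir zero_neq_one)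
  have "geo_deriv x p (pi / \<omega>) ?v = 0"
    using omega_pos by (simp add: geo_deriv_def great_circle_deriv_def hproj_orth_self pv rot_zero)
  moreover have "geo_deriv x p (pi / \<omega>) 0 = 0"
    by (rule linear_0[OF linear_geo_deriv])
  moreover have "0 \<in> tspace x"
    by (simp add: tspace_def)
  ultimately have "\<not> inj_on (geo_deriv x p (pi / \<omega>)) (tspace x)"
    using v(1) v0 by (metis inj_onD)
  then show ?thesis by (auto simp: conjugate_at_iff bij_betw_def)
qed

lemma not_conjugate_at_less:
  assumes t: "0 < t" "t < pi / \<omega>"
  shows "\<not> conjugate_at x p t"
proof -
  define c s where "c = cos (\<omega> * t)" and "s = sin (\<omega> * t)"
  have cs: "c * c + s * s = 1" by (simp add: c_def s_def flip: power2_eq_square)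
  have wt: "0 < \<omega> * t" "\<omega> * t < pi" using t omega_pos by (auto simp: field_simps)
  have s: "s > 0" unfolding s_def using wt by (rule sin_gt_zero)
  have sc: "\<omega> * t * c < s" unfolding s_def c_def using wt by (rule sin_greater_mult_cos)
  define y u where "y = c *\<^sub>R x + (s / \<omega>) *\<^sub>R p" and "u = (c / \<omega>) *\<^sub>R p - s *\<^sub>R x"
  have \<omega>: "\<omega> \<noteq> 0" using omega_pos by simp
  have xJp: "inner x (hopf_dir p) = - b" by (metis inner_hopf_dir_left inner_commute)
  have yu: "inner u y = 0" "inner u u = 1" "inner y y = 1"
    using cs \<omega> by (simp_all add: y_def u_def inner_add_left inner_add_right inner_diff_left inner_diff_right inner_pp)
  have uJy: "inner u (hopf_dir y) = b / \<omega>"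
  proof -
    have "inner u (hopf_dir y) = b / \<omega> * (c * c + s * s)"
      by (simp add: y_def u_def hopf_dir_add hopf_dir_scaleR inner_add_left inner_add_right inner_diff_left inner_diff_right xJp add_divide_distrib algebra_simps)
    then show ?thesis by (simp add: cs)
  qed
  have D: "geo_deriv x p t v = rot (- (b * t))
      ((inner p v / \<omega> * t) *\<^sub>R u + (s / \<omega>) *\<^sub>R (v - (inner p v / \<omega>\<^sup>2) *\<^sub>R p) - (t * inner v (hopf_dir x)) *\<^sub>R hopf_dir y)" for v
    by (simp add: geo_deriv_def great_circle_deriv_def u_def y_def s_def c_def)
  have g: "geo x p t = rot (- (b * t)) y"
    by (simp add: geo_def y_def s_def c_def)
  have perp: "inner x (v - (inner p v / \<omega>\<^sup>2) *\<^sub>R p) = 0" "inner p (v - (inner p v / \<omega>\<^sup>2) *\<^sub>R p) = 0"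
    if "v \<in> tspace x" for v
    using that \<omega> by (simp_all add: tspace_def inner_diff_right inner_commute[of x v] inner_pp power2_eq_square)
  have "bij_betw (geo_deriv x p t) (tspace x) (tspace (geo x p t))"
  proof (rule bij_betw_tspace[OF linear_geo_deriv])
    show "geo_deriv x p t ` tspace x \<subseteq> tspace (geo x p t)"
    proof clarify
      fix v assume v: "v \<in> tspace x"
      define vp where "vp = v - (inner p v / \<omega>\<^sup>2) *\<^sub>R p"
      have "inner vp y = 0"
        using perp[OF v] by (simp add: y_def inner_add_left vp_def inner_commute[of "v - _" "_ + _"])
      then have "inner (k *\<^sub>R u + (s / \<omega>) *\<^sub>R vp - m *\<^sub>R hopf_dir y) y = 0" for k m
        by (simp add: inner_add_left inner_diff_left yu)
      then show "geo_deriv x p t v \<in> tspace (geo x p t)"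
        by (simp add: tspace_def D g vp_def)
    qed
    show "x \<noteq> 0" by simp
    show "geo x p t \<noteq> 0" using norm_geo[of t] by auto
    fix v assume v: "v \<in> tspace x" and Dv: "geo_deriv x p t v = 0"
    \<comment> \<open>\<open>k\<close> is the component of \<open>v\<close> along p / \<omega>,
      \<open>vp\<close> the rest and \<open>\<beta>\<close> the fibre part of that rest. Pairing the
      kernel equation with the unit tangent \<open>u\<close> gives
      \<open>k = \<beta> * b * \<omega>\<close>. Pairing it with \<open>hopf_dir x\<close> cancels
      \<open>k\<close> and leaves \<beta> (s - \<omega> t c) = 0.\<close>
    define k vp \<beta> where "k = inner p v / \<omega>" and "vp = v - (inner p v / \<omega>\<^sup>2) *\<^sub>R p"
      and "\<beta> = inner vp (hopf_dir x)"
    have v_eq: "v = vp + (k / \<omega>) *\<^sub>R p" by (simp add: vp_def k_def power2_eq_square)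
    have vJ: "inner v (hopf_dir x) = \<beta> + k * b / \<omega>"
      by (subst v_eq) (simp add: \<beta>_def inner_add_left)
    have "norm (geo_deriv x p t v) = 0" using Dv by simp
    then have eq: "(k * t) *\<^sub>R u + (s / \<omega>) *\<^sub>R vp - (t * (\<beta> + k * b / \<omega>)) *\<^sub>R hopf_dir y = 0"
      unfolding D norm_rot vJ by (simp add: k_def vp_def)
    have perp': "inner x vp = 0" "inner p vp = 0" using perp[OF v] by (simp_all add: vp_def)
    have "inner u vp = 0" by (simp add: u_def inner_diff_left perp')
    then have "k * t - t * (\<beta> + k * b / \<omega>) * (b / \<omega>) = 0"
      using arg_cong[OF eq, of "inner u"]
      by (simp add: inner_add_right inner_diff_right yu uJy)
    then have "t * (k - (\<beta> + k * b / \<omega>) * (b / \<omega>)) = 0" by (simp add: algebra_simps)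
    then have "k - (\<beta> + k * b / \<omega>) * (b / \<omega>) = 0" using t by simp
    then have "k * \<omega>\<^sup>2 - \<beta> * b * \<omega> - k * b\<^sup>2 = 0"
      using \<omega> by (simp add: field_simps power2_eq_square)
    then have k: "k = \<beta> * b * \<omega>" unfolding omega_sq by (simp add: algebra_simps)
    have "inner (hopf_dir x) vp = \<beta>" by (simp add: \<beta>_def inner_commute)
    moreover have "inner (hopf_dir x) (hopf_dir y) = c" by (simp add: y_def inner_add_right)
    moreover have "inner (hopf_dir x) u = c * b / \<omega>"
      by (simp add: u_def inner_diff_right inner_commute)
    ultimately have "k * t * (c * b / \<omega>) + s / \<omega> * \<beta> - t * (\<beta> + k * b / \<omega>) * c = 0"
      using arg_cong[OF eq, of "inner (hopf_dir x)"]
      by (simp add: inner_add_right inner_diff_right)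
    then have "s / \<omega> * \<beta> - t * \<beta> * c = 0" using \<omega> by (simp add: algebra_simps)
    then have "\<beta> * (s - \<omega> * t * c) = 0" using \<omega> by (simp add: field_simps)
    then have "\<beta> = 0" using sc by simp
    then have "k = 0" by (simp add: k)
    then have "(s / \<omega>) *\<^sub>R vp = 0" using eq \<open>\<beta> = 0\<close> by simp
    then have "vp = 0" using s \<omega> by simp
    then show "v = 0" using v_eq \<open>k = 0\<close> by simp
  qed
  then show ?thesis by (simp add: conjugate_at_iff)
qed

lemma first_conj_time_pi: "first_conj_time x p (pi / \<omega>)"
  unfolding first_conj_time_def using conjugate_at_pi not_conjugate_at_less omega_pos by simp

end

subsection \<open>Lipschitz curves\<close>

lemma vector_derivative_difference_quotient:
  assumes "(f has_vector_derivative f') (at s)"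
  shows "(\<lambda>k. (f (s + inverse (real (Suc k))) - f s) /\<^sub>R inverse (real (Suc k))) \<longlonglongrightarrow> f'"
proof -
  have L: "(\<lambda>h. norm (f (s + h) - f s - h *\<^sub>R f') / norm h) \<midarrow>0\<rightarrow> 0"
    using assms unfolding has_vector_derivative_def has_derivative_at by blast
  have eq: "norm (f (s + h) - f s - h *\<^sub>R f') / norm h = norm ((f (s + h) - f s) /\<^sub>R h - f')" if "h \<noteq> 0" for h :: real
  proof -
    have "(f (s + h) - f s) /\<^sub>R h - f' = (f (s + h) - f s - h *\<^sub>R f') /\<^sub>R h"
      using that by (simp add: algebra_simps)
    then show ?thesis by (simp add: divide_inverse)
  qed
  have "(\<lambda>h. norm ((f (s + h) - f s) /\<^sub>R h - f')) \<midarrow>0\<rightarrow> 0"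
    by (rule Lim_transform_eventually[OF L], unfold eventually_at_filter, rule always_eventually) (use eq in blast)
  then have "(\<lambda>h. (f (s + h) - f s) /\<^sub>R h) \<midarrow>0\<rightarrow> f'"
    by (rule LIM_zero_cancel[OF tendsto_norm_zero_cancel])
  moreover have "filterlim (\<lambda>k. inverse (real (Suc k))) (at 0) sequentially"
    by (intro filterlim_atI LIMSEQ_inverse_real_of_nat) simp
  ultimately show ?thesis
    by (rule filterlim_compose)
qed

text \<open>The library theorem wants convergence at every point, so functions and limit are set to
  0 on \<open>N\<close>; integrals do not notice.\<close>

lemma dominated_convergence_off_negligible:
  fixes f :: "nat \<Rightarrow> real \<Rightarrow> real"
  assumes N: "negligible N" and f: "\<And>k. f k integrable_on {a..b}"
    and le: "\<And>k s. s \<in> {a..b} \<Longrightarrow> \<bar>f k s\<bar> \<le> K"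
    and lim: "\<And>s. s \<in> {a..b} - N \<Longrightarrow> (\<lambda>k. f k s) \<longlonglongrightarrow> g s"
  shows "g integrable_on {a..b}" "(\<lambda>k. integral {a..b} (f k)) \<longlonglongrightarrow> integral {a..b} g"
proof -
  let ?f = "\<lambda>k s. if s \<in> N then 0 else f k s" and ?g = "\<lambda>s. if s \<in> N then 0 else g s"
  have f': "?f k integrable_on {a..b}" for k
    by (rule integrable_spike[OF f N]) simp
  have K: "(\<lambda>s. K) integrable_on {a..b}" by (rule integrable_const_ivl)
  have bd: "norm (?f k s) \<le> K" if "s \<in> {a..b}" for k s
    using le[OF that] order_trans[OF abs_ge_zero le[OF that]] by simp
  have l: "(\<lambda>k. ?f k s) \<longlonglongrightarrow> ?g s" if "s \<in> {a..b}" for s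
    using lim that by simp
  note dc = dominated_convergence[OF f' K bd l]
  show "g integrable_on {a..b}"
    by (rule integrable_spike[OF dc(1) N]) simp_all
  have "integral {a..b} (?f k) = integral {a..b} (f k)" for k
    by (rule integral_spike[OF N]) simp
  moreover have "integral {a..b} ?g = integral {a..b} g"
    by (rule integral_spike[OF N]) simp
  ultimately show "(\<lambda>k. integral {a..b} (f k)) \<longlonglongrightarrow> integral {a..b} g"
    using dc(2) by simp
qed

section \<open>Difference quotients of a Lipschitz curve on the unit interval\<close>

definition clamp01 :: "real \<Rightarrow> real" where
  "clamp01 s = max 0 (min 1 s)"

lemma clamp01_in: "clamp01 s \<in> {0..1}"
  by (simp add: clamp01_def)

lemma lipschitz_clamp01:
  assumes "K-lipschitz_on {0..1} f"
  shows "K-lipschitz_on UNIV (\<lambda>s. f (clamp01 s))"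
proof (rule lipschitz_onI)
  show K: "0 \<le> K" by (rule lipschitz_on_nonneg[OF assms])
  fix s t :: real
  have "dist (f (clamp01 s)) (f (clamp01 t)) \<le> K * dist (clamp01 s) (clamp01 t)"
    by (rule lipschitz_onD[OF assms clamp01_in clamp01_in])
  also have "\<dots> \<le> K * dist s t"
    by (rule mult_left_mono[OF _ K]) (simp add: clamp01_def dist_real_def)
  finally show "dist (f (clamp01 s)) (f (clamp01 t)) \<le> K * dist s t" .
qed

text \<open>Extending by constants keeps the quotient defined up to the right end point.\<close>
definition diff_quot :: "(real \<Rightarrow> 'a::real_normed_vector) \<Rightarrow> nat \<Rightarrow> real \<Rightarrow> 'a" where
  "diff_quot f k s = (f (clamp01 (s + inverse (real (Suc k)))) - f (clamp01 s)) /\<^sub>R inverse (real (Suc k))"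

lemma norm_diff_quot_le:
  assumes "K-lipschitz_on {0..1} f"
  shows "norm (diff_quot f k s) \<le> K"
proof -
  have "norm (f (clamp01 (s + inverse (real (Suc k)))) - f (clamp01 s)) \<le> K * inverse (real (Suc k))"
    using lipschitz_onD[OF lipschitz_clamp01[OF assms], of "s + inverse (real (Suc k))" s]
    by (simp add: dist_norm)
  then have "real (Suc k) * norm (f (clamp01 (s + inverse (real (Suc k)))) - f (clamp01 s)) \<le> K"
    by (simp add: field_simps)
  then show ?thesis by (simp add: diff_quot_def)
qed

lemma continuous_on_clamp01:
  assumes "K-lipschitz_on {0..1} f"
  shows "continuous_on S (\<lambda>s. f (clamp01 s))"
  using lipschitz_on_continuous_on[OF lipschitz_clamp01[OF assms]] continuous_on_subset by blast

lemma continuous_on_diff_quot: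
  assumes "K-lipschitz_on {0..1} f"
  shows "continuous_on S (diff_quot f k)"
  unfolding diff_quot_def[abs_def]
  by (intro continuous_intros continuous_on_clamp01[OF assms]
      continuous_on_compose2[OF continuous_on_clamp01[OF assms, of UNIV], where f="\<lambda>s. s + _"]) auto

lemma diff_quot_tendsto:
  assumes "(f has_vector_derivative f') (at s)" "0 < s" "s < 1"
  shows "(\<lambda>k. diff_quot f k s) \<longlonglongrightarrow> f'"
proof -
  have "((\<lambda>s. f (clamp01 s)) has_vector_derivative f') (at s)"
    by (rule has_vector_derivative_transform_within_open[OF assms(1), of "{0<..<1}"])
      (use assms in \<open>auto simp: clamp01_def\<close>)
  from vector_derivative_difference_quotient[OF this] show ?thesis
    by (simp add: diff_quot_def)
qed

text \<open>With an antiderivative P of the extended function, the integral of the difference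
  quotient of f is the difference quotient of P at 1 minus the one at 0, and P is differentiable
  there.\<close>

lemma integral_diff_quot_tendsto:
  fixes f :: "real \<Rightarrow> real"
  assumes "K-lipschitz_on {0..1} f"
  shows "(\<lambda>k. integral {0..1} (diff_quot f k)) \<longlonglongrightarrow> f 1 - f 0"
proof -
  \<comment> \<open>The shifted argument reaches at most 2; the larger interval makes all
    derivatives of \<open>P\<close> that are used two-sided.\<close>
  obtain P where P: "\<And>s. s \<in> {-1..3} \<Longrightarrow> (P has_vector_derivative f (clamp01 s)) (at s within {-1..3})"
    using antiderivative_continuous[OF continuous_on_clamp01[OF assms]] by blast
  have P': "(P has_vector_derivative f (clamp01 s)) (at s)" if "-1 < s" "s < 3" for s
    using P[of s] that by (simp add: at_within_Icc_at)
  let ?d = "\<lambda>k. inverse (real (Suc k))"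
  have "(diff_quot f k has_integral (P (1 + ?d k) - P 1) /\<^sub>R ?d k - (P (0 + ?d k) - P 0) /\<^sub>R ?d k) {0..1}" for k
  proof -
    have d: "0 < ?d k" "?d k \<le> 1" by (simp_all add: field_simps)
    show ?thesis
    proof (rule fundamental_theorem_of_calculus[where f="\<lambda>s. (P (s + ?d k) - P s) /\<^sub>R ?d k"])
      fix s :: real assume s: "s \<in> {0..1}"
      have shift: "((\<lambda>s. s + ?d k) has_vector_derivative 1) (at s)"
        by (auto intro!: derivative_eq_intros)
      have "(P has_vector_derivative f (clamp01 (s + ?d k))) (at (s + ?d k))"
        by (rule P') (use s d in \<open>unfold atLeastAtMost_iff, linarith\<close>)+
      from vector_diff_chain_at[OF shift this]
      have "((\<lambda>s. P (s + ?d k)) has_vector_derivative f (clamp01 (s + ?d k))) (at s)"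
        by (simp add: o_def)
      then have "((\<lambda>s. (P (s + ?d k) - P s) /\<^sub>R ?d k) has_vector_derivative diff_quot f k s) (at s)"
        unfolding diff_quot_def using P'[of s] s
        by (intro bounded_linear.has_vector_derivative[OF bounded_linear_scaleR_right] has_vector_derivative_diff) auto
      then show "((\<lambda>s. (P (s + ?d k) - P s) /\<^sub>R ?d k) has_vector_derivative diff_quot f k s) (at s within {0..1})"
        by (rule has_vector_derivative_at_within)
    qed simp
  qed
  then have "integral {0..1} (diff_quot f k) = (P (1 + ?d k) - P 1) /\<^sub>R ?d k - (P (0 + ?d k) - P 0) /\<^sub>R ?d k" for k
    by blast
  moreover have "(\<lambda>k. (P (1 + ?d k) - P 1) /\<^sub>R ?d k - (P (0 + ?d k) - P 0) /\<^sub>R ?d k) \<longlonglongrightarrow> f (clamp01 1) - f (clamp01 0)"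
    by (intro tendsto_diff vector_derivative_difference_quotient P') auto
  ultimately show ?thesis by (simp add: clamp01_def)
qed

lemma negligible_with_endpoints: "negligible N \<Longrightarrow> negligible (N \<union> {0, 1::real})"
  by (rule negligible_Un) (auto intro: negligible_finite)

text \<open>Difference quotients are bounded by the Lipschitz constant and converge to
  \<open>f'\<close> almost everywhere. Dominated convergence identifies the limit of their
  integrals, which is also \<open>f 1 - f 0\<close>.\<close>

lemma lipschitz_FTC:
  fixes f :: "real \<Rightarrow> real"
  assumes "K-lipschitz_on {0..1} f" and N: "negligible N"
    and d: "\<And>s. s \<in> {0..1} - N \<Longrightarrow> (f has_real_derivative f' s) (at s)"
  shows "(f' has_integral f 1 - f 0) {0..1}"
proof -
  have lim: "(\<lambda>k. diff_quot f k s) \<longlonglongrightarrow> f' s" if "s \<in> {0..1} - (N \<union> {0, 1})" for s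
    using that d[of s] by (intro diff_quot_tendsto) (auto simp: has_real_derivative_iff_has_vector_derivative)
  note dc = dominated_convergence_off_negligible[OF negligible_with_endpoints[OF N]
      integrable_continuous_real[OF continuous_on_diff_quot[OF assms(1)]]
      norm_diff_quot_le[OF assms(1), unfolded real_norm_def] lim]
  have "integral {0..1} f' = f 1 - f 0"
    by (rule LIMSEQ_unique[OF dc(2) integral_diff_quot_tendsto[OF assms(1)]])
  then show ?thesis using dc(1) by (metis has_integral_integral)
qed

text \<open>Norms of difference quotients are continuous, uniformly bounded and converge almost
  everywhere to the speed. The approximant \<open>w\<close> will serve as the rate of rotation:
  continuity makes the phase differentiable, the positive lower bound allows division by its
  integral.\<close>

lemma lipschitz_speed:
  fixes \<gamma> :: "real \<Rightarrow> 'a::real_normed_vector"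
  assumes lip: "K-lipschitz_on {0..1} \<gamma>" and N: "negligible N"
    and d: "\<And>s. s \<in> {0..1} - N \<Longrightarrow> (\<gamma> has_vector_derivative g s) (at s)"
  shows lipschitz_speed_integrable: "(\<lambda>s. norm (g s)) integrable_on {0..1}"
    and lipschitz_speed_approx: "\<And>\<epsilon>. \<epsilon> > 0 \<Longrightarrow> \<exists>w. continuous_on {0..1} w \<and> (\<forall>s\<in>{0..1}. \<epsilon> / 2 \<le> w s) \<and>
        (\<lambda>s. \<bar>norm (g s) - w s\<bar>) integrable_on {0..1} \<and> integral {0..1} (\<lambda>s. \<bar>norm (g s) - w s\<bar>) \<le> \<epsilon>"
proof -
  note N' = negligible_with_endpoints[OF N]
  have lim: "(\<lambda>k. norm (diff_quot \<gamma> k s)) \<longlonglongrightarrow> norm (g s)" if "s \<in> {0..1} - (N \<union> {0, 1})" for s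
    using that d[of s] by (intro tendsto_norm diff_quot_tendsto) auto
  have cont: "continuous_on {0..1} (\<lambda>s. norm (diff_quot \<gamma> k s))" for k
    by (intro continuous_intros continuous_on_diff_quot[OF lip])
  have bd: "\<bar>norm (diff_quot \<gamma> k s)\<bar> \<le> K" for k s
    using norm_diff_quot_le[OF lip] by simp
  show int: "(\<lambda>s. norm (g s)) integrable_on {0..1}"
    using dominated_convergence_off_negligible(1)[OF N' integrable_continuous_real[OF cont] bd lim] by blast
  fix \<epsilon> :: real assume \<epsilon>: "\<epsilon> > 0"
  have gK: "norm (g s) \<le> K" if "s \<in> {0..1} - (N \<union> {0, 1})" for s
    by (rule LIMSEQ_le_const2[OF lim[OF that]]) (use norm_diff_quot_le[OF lip] in blast)
  \<comment> \<open>\<open>g\<close> is arbitrary on the exceptional set; the error is set to 0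
    there so that the bound \<open>2 * K\<close> holds everywhere.\<close>
  let ?e = "\<lambda>k s. if s \<in> N \<union> {0, 1} then 0 else \<bar>norm (g s) - norm (diff_quot \<gamma> k s)\<bar>"
  let ?v = "\<lambda>s. if s \<in> N \<union> {0, 1} then 0 else norm (g s)"
  have gabs: "(\<lambda>s. norm (g s)) absolutely_integrable_on {0..1}"
    by (rule nonnegative_absolutely_integrable_1[OF int]) simp
  have ei': "(\<lambda>s. \<bar>norm (g s) - w s\<bar>) integrable_on {0..1}" if "continuous_on {0..1} w" for w :: "real \<Rightarrow> real"
  proof -
    have "w absolutely_integrable_on {0..1}"
      by (rule absolutely_integrable_continuous_real[OF that])
    then have "(\<lambda>s. norm (g s) - w s) absolutely_integrable_on {0..1}"
      using gabs by (intro set_integral_diff)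
    then show ?thesis
      by (simp add: absolutely_integrable_on_def)
  qed
  have ei: "?e k integrable_on {0..1}" for k
    by (rule integrable_spike[OF ei'[OF cont[of k]] N']) simp
  have eb: "\<bar>?e k s\<bar> \<le> 2 * K" if "s \<in> {0..1}" for k s
  proof -
    have "\<bar>norm (g s) - norm (diff_quot \<gamma> k s)\<bar> \<le> 2 * K" if "s \<notin> N \<union> {0,1}"
    proof -
      have "norm (g s) \<le> K" using gK \<open>s \<in> {0..1}\<close> that by blast
      then show ?thesis
        using norm_diff_quot_le[OF lip, of k s] norm_ge_zero[of "g s"] norm_ge_zero[of "diff_quot \<gamma> k s"]
        by linarith
    qed
    then show ?thesis using lipschitz_on_nonneg[OF lip] by auto
  qed
  have el: "(\<lambda>k. ?e k s) \<longlonglongrightarrow> 0" if "s \<in> {0..1} - {}" for s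
  proof (cases "s \<in> N \<union> {0, 1}")
    case False
    then have "(\<lambda>k. norm (diff_quot \<gamma> k s)) \<longlonglongrightarrow> norm (g s)" using lim that by blast
    from tendsto_rabs[OF tendsto_diff[OF tendsto_const this]]
    have "(\<lambda>k. \<bar>norm (g s) - norm (diff_quot \<gamma> k s)\<bar>) \<longlonglongrightarrow> \<bar>norm (g s) - norm (g s)\<bar>" .
    then show ?thesis using False by (simp only: if_False diff_self abs_zero)
  qed simp
  have "(\<lambda>k. integral {0..1} (?e k)) \<longlonglongrightarrow> integral {0..1} (\<lambda>s::real. 0)"
    by (rule dominated_convergence_off_negligible(2)[OF negligible_empty ei eb el])
  then have "(\<lambda>k. integral {0..1} (?e k)) \<longlonglongrightarrow> 0" by simp
  then have "\<forall>\<^sub>F k in sequentially. integral {0..1} (?e k) < \<epsilon> / 2"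
    using \<epsilon> by (intro order_tendstoD) auto
  then obtain k where k: "integral {0..1} (?e k) < \<epsilon> / 2"
    using eventually_happens'[OF sequentially_bot] by blast
  \<comment> \<open>Half of \<open>\<epsilon>\<close> pays for the difference quotient, the other
    half for the shift that keeps \<open>w\<close> away from 0.\<close>
  define w where "w = (\<lambda>s. norm (diff_quot \<gamma> k s) + \<epsilon> / 2)"
  have wc: "continuous_on {0..1} w" unfolding w_def by (intro continuous_intros cont)
  have "integral {0..1} (\<lambda>s. \<bar>norm (g s) - w s\<bar>) \<le> integral {0..1} (\<lambda>s. \<bar>norm (g s) - norm (diff_quot \<gamma> k s)\<bar> + \<epsilon> / 2)"
    by (rule integral_le[OF ei'[OF wc] integrable_add[OF ei'[OF cont] integrable_const_ivl]])
      (use \<epsilon> in \<open>simp add: w_def\<close>)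
  also have "\<dots> = integral {0..1} (\<lambda>s. \<bar>norm (g s) - norm (diff_quot \<gamma> k s)\<bar>) + \<epsilon> / 2"
    by (subst integral_add[OF ei'[OF cont] integrable_const_ivl]) simp
  also have "integral {0..1} (\<lambda>s. \<bar>norm (g s) - norm (diff_quot \<gamma> k s)\<bar>) = integral {0..1} (?e k)"
    by (rule integral_spike[OF N']) simp
  finally have "integral {0..1} (\<lambda>s. \<bar>norm (g s) - w s\<bar>) \<le> \<epsilon>" using k by simp
  moreover have "\<forall>s\<in>{0..1}. \<epsilon> / 2 \<le> w s" by (simp add: w_def)
  ultimately show "\<exists>w. continuous_on {0..1} w \<and> (\<forall>s\<in>{0..1}. \<epsilon> / 2 \<le> w s) \<and>
        (\<lambda>s. \<bar>norm (g s) - w s\<bar>) integrable_on {0..1} \<and> integral {0..1} (\<lambda>s. \<bar>norm (g s) - w s\<bar>) \<le> \<epsilon>"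
    using wc ei'[OF wc] by blast
qed

lemma norm_rot_diff_le: "norm (rot a v - rot b v) \<le> 2 * \<bar>a - b\<bar> * norm v"
proof -
  have lip: "\<bar>f a - f b\<bar> \<le> \<bar>a - b\<bar>"
    if "\<And>s. (f has_real_derivative f' s) (at s)" "\<And>s. \<bar>f' s\<bar> \<le> 1" for f f' :: "real \<Rightarrow> real"
    using field_differentiable_bound[of UNIV f f' 1 a b] that by simp
  have c: "\<bar>cos a - cos b\<bar> \<le> \<bar>a - b\<bar>"
    by (rule lip[of cos "\<lambda>s. - sin s"]) (auto intro!: derivative_eq_intros simp: abs_sin_le_one)
  have s: "\<bar>sin a - sin b\<bar> \<le> \<bar>a - b\<bar>"
    by (rule lip[of sin cos]) (auto intro!: derivative_eq_intros simp: abs_cos_le_one)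
  have "norm (rot a v - rot b v) = norm ((cos a - cos b) *\<^sub>R v + (sin a - sin b) *\<^sub>R hopf_dir v)"
    by (simp add: rot_def algebra_simps)
  also have "\<dots> \<le> \<bar>cos a - cos b\<bar> * norm v + \<bar>sin a - sin b\<bar> * norm v"
    by (rule order_trans[OF norm_triangle_ineq]) simp
  also have "\<dots> \<le> 2 * \<bar>a - b\<bar> * norm v"
    using mult_right_mono[OF c norm_ge_zero[of v]] mult_right_mono[OF s norm_ge_zero[of v]] by simp
  finally show ?thesis .
qed

text \<open>The derivative of arccos is unbounded at -1 and 1; scaling by \<open>r\<close> confines
  the argument to [-r, r].\<close>

lemma lipschitz_arccos_scaled:
  assumes "0 < r" "r < 1"
  shows "(inverse (sqrt (1 - r\<^sup>2)))-lipschitz_on {-1..1} (\<lambda>a. arccos (r * a))"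
proof (rule lipschitz_onI)
  have "r * r < 1 * 1" by (rule mult_strict_mono) (use assms in auto)
  then have r2: "0 < 1 - r\<^sup>2" by (simp add: power2_eq_square)
  then show "0 \<le> inverse (sqrt (1 - r\<^sup>2))" by simp
  fix a a' :: real assume "a \<in> {-1..1}" "a' \<in> {-1..1}"
  have "norm (arccos (r * a) - arccos (r * a')) \<le> inverse (sqrt (1 - r\<^sup>2)) * norm (a - a')"
  proof (rule field_differentiable_bound[of "{-1..1}"])
    fix z :: real assume z: "z \<in> {-1..1}"
    then have "\<bar>r * z\<bar> \<le> r * 1" using assms unfolding abs_mult by (intro mult_mono) auto
    then have rz: "-1 < r * z" "r * z < 1" "\<bar>r * z\<bar> \<le> \<bar>r\<bar>" using assms by auto
    from DERIV_chain2[OF DERIV_arccos[OF rz(1,2)] DERIV_cmult[OF DERIV_ident]]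
    show "((\<lambda>a. arccos (r * a)) has_real_derivative inverse (- sqrt (1 - (r * z)\<^sup>2)) * (r * 1)) (at z within {-1..1})"
      by (rule has_field_derivative_at_within)
    have "(r * z)\<^sup>2 \<le> r\<^sup>2" using rz(3) by (rule abs_le_square_iff[THEN iffD1])
    then have "sqrt (1 - r\<^sup>2) \<le> sqrt (1 - (r * z)\<^sup>2)" by simp
    moreover have r0: "0 < sqrt (1 - r\<^sup>2)" using r2 by (simp only: real_sqrt_gt_0_iff)
    moreover define q where "q = inverse (sqrt (1 - (r * z)\<^sup>2))"
    ultimately have q: "q \<le> inverse (sqrt (1 - r\<^sup>2))" "0 < q"
      unfolding q_def by (blast intro: le_imp_inverse_le, blast intro: positive_imp_inverse_positive less_le_trans)
    have "norm (inverse (- sqrt (1 - (r * z)\<^sup>2)) * (r * 1)) = q * r"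
      using assms q(2) by (simp add: q_def[symmetric] abs_mult)
    also have "\<dots> \<le> q" using assms q(2) by simp
    also note q(1)
    finally show "norm (inverse (- sqrt (1 - (r * z)\<^sup>2)) * (r * 1)) \<le> inverse (sqrt (1 - r\<^sup>2))" .
  qed (use \<open>a \<in> _\<close> \<open>a' \<in> _\<close> in auto)
  then show "dist (arccos (r * a)) (arccos (r * a')) \<le> inverse (sqrt (1 - r\<^sup>2)) * dist a a'"
    by (simp add: dist_norm)
qed

subsection \<open>The lower bound for the length\<close>

text \<open>Triangle inequality for (v, k w) = w (1, k) + (v - w, 0). It exchanges the true speed
  \<open>v\<close> for its approximation \<open>w\<close> at the price of the L^1 error.\<close>

lemma sqrt_sum_squares_le_add_abs_diff:
  fixes v w k :: real
  assumes "0 \<le> w"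
  shows "sqrt (v\<^sup>2 + (k * w)\<^sup>2) \<le> sqrt (1 + k\<^sup>2) * w + \<bar>v - w\<bar>"
proof -
  have "sqrt (v\<^sup>2 + (k * w)\<^sup>2) = norm (Complex v (k * w))"
    by (simp add: complex_norm)
  also have "Complex v (k * w) = complex_of_real w * Complex 1 k + complex_of_real (v - w)"
    by (simp add: complex_eq_iff)
  also have "norm \<dots> \<le> norm (complex_of_real w * Complex 1 k) + norm (complex_of_real (v - w))"
    by (rule norm_triangle_ineq)
  also have "\<dots> = sqrt (1 + k\<^sup>2) * w + \<bar>v - w\<bar>"
    unfolding norm_mult norm_of_real using assms by (simp add: complex_norm)
  finally show ?thesis .
qed

text \<open>The angle to a fixed unit vector changes at most at the speed of the curve; the factor \<open>r < 1\<close>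
  removes the singularity of \<open>arccos\<close> at the end points.\<close>
lemma arccos_scaled_rate:
  fixes x y y' :: "'a::real_inner"
  assumes "norm x = 1" "norm y = 1" "inner y' y = 0" "0 < r" "r < 1"
  shows "\<bar>inverse (- sqrt (1 - (r * inner x y)\<^sup>2)) * (r * inner x y')\<bar> \<le> norm y'"
proof -
  define f where "f = inner x y"
  have xx: "inner x x = 1" "inner y y = 1" using assms by (simp_all add: norm_eq_1)
  have f1: "f\<^sup>2 \<le> 1"
    using Cauchy_Schwarz_ineq[of x y] by (simp add: f_def xx)
  \<comment> \<open>Since \<open>y'\<close> is orthogonal to \<open>y\<close>, only the part of
    \<open>x\<close> orthogonal to \<open>y\<close> matters, and its norm compensates the
    denominator in the derivative of arccos.\<close>
  have "inner (x - f *\<^sub>R y) (x - f *\<^sub>R y) = 1 - f\<^sup>2"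
    by (simp add: inner_diff_left inner_diff_right xx f_def inner_commute[of y x] power2_eq_square)
  then have n: "norm (x - f *\<^sub>R y) = sqrt (1 - f\<^sup>2)" by (simp add: norm_eq_sqrt_inner)
  have "inner x y' = inner (x - f *\<^sub>R y) y'"
    using assms(3) inner_commute[of y y'] by (simp add: inner_diff_left)
  then have "\<bar>inner x y'\<bar> \<le> sqrt (1 - f\<^sup>2) * norm y'"
    using Cauchy_Schwarz_ineq2[of "x - f *\<^sub>R y" y'] by (simp add: n)
  then have "r * \<bar>inner x y'\<bar> \<le> r * (sqrt (1 - f\<^sup>2) * norm y')"
    using assms by (intro mult_left_mono) auto
  also have "\<dots> = (r * sqrt (1 - f\<^sup>2)) * norm y'" by simp
  also have "\<dots> \<le> sqrt (1 - (r * f)\<^sup>2) * norm y'"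
  proof (rule mult_right_mono)
    have "r\<^sup>2 \<le> 1" using assms by (simp add: power_le_one)
    then have "r\<^sup>2 * (1 - f\<^sup>2) \<le> 1 - (r * f)\<^sup>2" by (simp add: power_mult_distrib algebra_simps)
    then have "sqrt (r\<^sup>2 * (1 - f\<^sup>2)) \<le> sqrt (1 - (r * f)\<^sup>2)" by (rule real_sqrt_le_mono)
    then show "r * sqrt (1 - f\<^sup>2) \<le> sqrt (1 - (r * f)\<^sup>2)" using assms by (simp add: real_sqrt_mult)
  qed simp
  finally have *: "r * \<bar>inner x y'\<bar> \<le> sqrt (1 - (r * f)\<^sup>2) * norm y'" .
  have "\<bar>f\<bar> \<le> 1" using f1 by (simp add: abs_square_le_1)
  then have "\<bar>r * f\<bar> \<le> r * 1" unfolding abs_mult using assms by (intro mult_mono) auto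
  then have "\<bar>r * f\<bar> < 1" using assms by linarith
  then have "(r * f)\<^sup>2 < 1" by (simp add: abs_square_less_1)
  then have pos: "0 < sqrt (1 - (r * f)\<^sup>2)" by simp
  have "\<bar>inverse (- sqrt (1 - (r * f)\<^sup>2)) * (r * inner x y')\<bar> = r * \<bar>inner x y'\<bar> / sqrt (1 - (r * f)\<^sup>2)"
    using pos assms(4) by (simp only: abs_mult abs_inverse abs_minus_cancel abs_of_pos divide_inverse mult.commute)
  also have "\<dots> \<le> norm y'"
    using * pos by (simp only: pos_divide_le_eq mult.commute)
  finally show ?thesis by (simp only: f_def)
qed

text \<open>The angle \<open>h\<close> between \<open>x\<close> and the rotated curve is
  differentiated and its rate integrated. \<open>\<epsilon>\<close> measures the replacement of the
  speed by \<open>w\<close>, and \<open>r\<close> regularises arccos; both disappear in the limit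
  taken afterwards.\<close>

lemma twisted_length_bound_aux:
  fixes \<gamma> :: "real \<Rightarrow> complex^'m"
  assumes lip: "K-lipschitz_on {0..1} \<gamma>" and sph: "\<And>s. s \<in> {0..1} \<Longrightarrow> norm (\<gamma> s) = 1"
    and N: "negligible N"
    and d: "\<And>s. s \<in> {0..1} - N \<Longrightarrow> (\<gamma> has_vector_derivative g s) (at s)"
    and hor: "\<And>s. s \<in> {0..1} - N \<Longrightarrow> g s \<in> hdist (\<gamma> s)"
    and \<epsilon>: "0 < \<epsilon>" and r: "0 < r" "r < 1"
  shows "arccos (r * inner (\<gamma> 0) (rot c (\<gamma> 1))) - arccos r
     \<le> sqrt ((integral {0..1} (\<lambda>s. norm (g s)) + \<epsilon>)\<^sup>2 + c\<^sup>2) + \<epsilon>"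
proof -
  let ?v = "\<lambda>s. norm (g s)"
  have vi: "?v integrable_on {0..1}" by (rule lipschitz_speed_integrable[OF lip N d])
  obtain w where wc: "continuous_on {0..1} w" and wpos: "\<And>s. s \<in> {0..1} \<Longrightarrow> \<epsilon> / 2 \<le> w s"
    and ei: "(\<lambda>s. \<bar>?v s - w s\<bar>) integrable_on {0..1}"
    and ele: "integral {0..1} (\<lambda>s. \<bar>?v s - w s\<bar>) \<le> \<epsilon>"
    using lipschitz_speed_approx[OF lip N d \<epsilon>] by blast
  have wi: "w integrable_on {0..1}" by (rule integrable_continuous_real[OF wc])
  define \<Lambda> where "\<Lambda> = integral {0..1} w"
  have "integral {0..1} (\<lambda>s::real. \<epsilon> / 2) \<le> \<Lambda>"
    unfolding \<Lambda>_def by (rule integral_le[OF integrable_const_ivl wi wpos])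
  then have \<Lambda>: "0 < \<Lambda>" using \<epsilon> by simp
  have "\<Lambda> \<le> integral {0..1} (\<lambda>s. ?v s + \<bar>?v s - w s\<bar>)"
    unfolding \<Lambda>_def by (rule integral_le[OF wi integrable_add[OF vi ei]]) simp
  also have "\<dots> = integral {0..1} ?v + integral {0..1} (\<lambda>s. \<bar>?v s - w s\<bar>)"
    by (rule integral_add[OF vi ei])
  finally have \<Lambda>le: "\<Lambda> \<le> integral {0..1} ?v + \<epsilon>" using ele by simp
  \<comment> \<open>The phase has rate \<open>k * w\<close>, so its total over the unit interval is
    exactly \<open>c\<close>.\<close>
  define k where "k = c / \<Lambda>"
  define \<theta> where "\<theta> = (\<lambda>s. k * integral {0..s} w)"
  have \<theta>d: "(\<theta> has_real_derivative k * w s) (at s within {0..1})" if "s \<in> {0..1}" for s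
    unfolding \<theta>_def by (intro DERIV_cmult integral_has_real_derivative[OF wc that])
  have \<theta>01: "\<theta> 0 = 0" "\<theta> 1 = c" using \<Lambda> by (simp_all add: \<theta>_def k_def \<Lambda>_def)
  obtain W where W: "\<And>s. s \<in> {0..1} \<Longrightarrow> \<bar>k * w s\<bar> \<le> W"
  proof -
    have "bounded ((\<lambda>s. k * w s) ` {0..1})"
      by (intro compact_imp_bounded compact_continuous_image continuous_intros wc) simp
    then obtain B where "\<forall>s\<in>{0..1}. norm (k * w s) \<le> B" by (auto simp: bounded_iff)
    then show ?thesis using that[of B] by simp
  qed
  have W0: "0 \<le> W" using W[of 0] by simp
  have \<theta>lip: "\<bar>\<theta> s - \<theta> t\<bar> \<le> W * \<bar>s - t\<bar>" if "s \<in> {0..1}" "t \<in> {0..1}" for s t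
    using field_differentiable_bound[of "{0..1}" \<theta> "\<lambda>s. k * w s" W s t] \<theta>d W that by simp
  define x y where "x = \<gamma> 0" and "y = (\<lambda>s. rot (\<theta> s) (\<gamma> s))"
  have nx: "norm x = 1" using sph[of 0] by (simp add: x_def)
  have ny: "norm (y s) = 1" if "s \<in> {0..1}" for s using sph[OF that] by (simp add: y_def)
  have ylip: "(K + 2 * W)-lipschitz_on {0..1} y"
  proof (rule lipschitz_onI)
    show "0 \<le> K + 2 * W" using W0 lipschitz_on_nonneg[OF lip] by simp
    fix s t :: real assume st: "s \<in> {0..1}" "t \<in> {0..1}"
    have "y s - y t = rot (\<theta> s) (\<gamma> s - \<gamma> t) + (rot (\<theta> s) (\<gamma> t) - rot (\<theta> t) (\<gamma> t))"
      by (simp add: y_def rot_diff)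
    then have "norm (y s - y t) \<le> norm (\<gamma> s - \<gamma> t) + norm (rot (\<theta> s) (\<gamma> t) - rot (\<theta> t) (\<gamma> t))"
      by (metis norm_triangle_ineq norm_rot)
    also have "\<dots> \<le> K * \<bar>s - t\<bar> + 2 * (W * \<bar>s - t\<bar>)"
      using lipschitz_onD[OF lip st] norm_rot_diff_le[of "\<theta> s" "\<gamma> t" "\<theta> t"] \<theta>lip[OF st] sph[OF st(2)]
      by (simp add: dist_norm)
    finally show "dist (y s) (y t) \<le> (K + 2 * W) * dist s t"
      by (simp add: dist_norm algebra_simps)
  qed
  define f where "f = (\<lambda>s. inner x (y s))"
  have f1: "f s \<in> {-1..1}" if "s \<in> {0..1}" for s
    using Cauchy_Schwarz_ineq2[of x "y s"] nx ny[OF that] by (auto simp: f_def)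
  have flip: "(K + 2 * W)-lipschitz_on {0..1} f"
  proof (rule lipschitz_onI)
    show "0 \<le> K + 2 * W" by (rule lipschitz_on_nonneg[OF ylip])
    fix s t :: real assume st: "s \<in> {0..1}" "t \<in> {0..1}"
    have "\<bar>f s - f t\<bar> \<le> norm (y s - y t)"
      using Cauchy_Schwarz_ineq2[of x "y s - y t"] nx by (simp add: f_def inner_diff_right)
    then show "dist (f s) (f t) \<le> (K + 2 * W) * dist s t"
      using lipschitz_onD[OF ylip st] by (simp add: dist_norm)
  qed
  define h where "h = (\<lambda>s. arccos (r * f s))"
  obtain H where hlip: "H-lipschitz_on {0..1} h"
  proof -
    have "(inverse (sqrt (1 - r\<^sup>2)))-lipschitz_on (f ` {0..1}) (\<lambda>a. arccos (r * a))"
      by (rule lipschitz_on_subset[OF lipschitz_arccos_scaled[OF r]]) (use f1 in blast)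
    from lipschitz_on_compose2[OF flip this] show ?thesis using that unfolding h_def by blast
  qed
  define y' where "y' = (\<lambda>s. rot (\<theta> s) (g s + (k * w s) *\<^sub>R hopf_dir (\<gamma> s)))"
  define h' where "h' = (\<lambda>s. inverse (- sqrt (1 - (r * inner x (y s))\<^sup>2)) * (r * inner x (y' s)))"
  have hder: "(h has_real_derivative h' s) (at s)" if s: "s \<in> {0..1} - (N \<union> {0, 1})" for s
  proof -
    have s01: "s \<in> {0..1}" "0 < s" "s < 1" using s by auto
    have \<theta>d': "(\<theta> has_real_derivative k * w s) (at s)"
      using \<theta>d[OF s01(1)] s01 by (simp add: at_within_Icc_at)
    have yd: "(y has_vector_derivative y' s) (at s)"
      unfolding y_def y'_def using s by (intro has_vector_derivative_rot \<theta>d' d) auto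
    have "(f has_real_derivative inner x (y' s)) (at s)"
      using bounded_linear.has_vector_derivative[OF bounded_linear_inner_right yd, of x]
      by (simp add: f_def has_real_derivative_iff_has_vector_derivative)
    then have fd: "((\<lambda>s. r * f s) has_real_derivative r * inner x (y' s)) (at s)"
      by (rule DERIV_cmult)
    have "\<bar>r * f s\<bar> \<le> r * 1" unfolding abs_mult using f1[OF s01(1)] r by (intro mult_mono) auto
    then have "-1 < r * f s" "r * f s < 1" using r by auto
    from DERIV_chain2[OF DERIV_arccos[OF this] fd]
    show ?thesis by (simp add: h_def h'_def f_def)
  qed
  have hbd: "h' s \<le> sqrt (1 + k\<^sup>2) * w s + \<bar>?v s - w s\<bar>" if s: "s \<in> {0..1} - (N \<union> {0, 1})" for s
  proof -
    have s01: "s \<in> {0..1}" using s by auto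
    have g: "inner (g s) (\<gamma> s) = 0" "inner (g s) (hopf_dir (\<gamma> s)) = 0"
      using hor[of s] s by (auto simp: hdist_def)
    have gg: "inner (\<gamma> s) (\<gamma> s) = 1" using sph[OF s01] by (simp add: norm_eq_1)
    have y'y: "inner (y' s) (y s) = 0"
      by (simp add: y_def y'_def inner_add_left g)
    have g': "inner (hopf_dir (\<gamma> s)) (g s) = 0" using g(2) by (simp add: inner_commute)
    have "inner (y' s) (y' s) = inner (g s) (g s) + (k * w s) * (k * w s)"
      by (simp add: y'_def inner_add_left inner_add_right g g' gg)
    also have "\<dots> = (?v s)\<^sup>2 + (k * w s)\<^sup>2"
      by (simp only: power2_norm_eq_inner power2_eq_square[of "k * w s"])
    finally have "inner (y' s) (y' s) = (?v s)\<^sup>2 + (k * w s)\<^sup>2" .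
    then have "norm (y' s) = sqrt ((?v s)\<^sup>2 + (k * w s)\<^sup>2)" by (simp add: norm_eq_sqrt_inner)
    also have "\<dots> \<le> sqrt (1 + k\<^sup>2) * w s + \<bar>?v s - w s\<bar>"
      using wpos[OF s01] \<epsilon> by (intro sqrt_sum_squares_le_add_abs_diff) simp
    finally show ?thesis
      using arccos_scaled_rate[OF nx ny[OF s01] y'y r] unfolding h'_def by linarith
  qed
  note N' = negligible_with_endpoints[OF N]
  \<comment> \<open>\<open>has_integral_le\<close> compares at every point, but \<open>hbd\<close>
    is known only off a null set. Elsewhere 0 is a safe value because the majorant is
    nonnegative.\<close>
  have 1: "((\<lambda>s. if s \<in> N \<union> {0, 1} then 0 else h' s) has_integral h 1 - h 0) {0..1}"
    by (rule has_integral_spike[OF N' _ lipschitz_FTC[OF hlip N' hder]]) simp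
  have 2: "((\<lambda>s. sqrt (1 + k\<^sup>2) * w s + \<bar>?v s - w s\<bar>) has_integral
      sqrt (1 + k\<^sup>2) * \<Lambda> + integral {0..1} (\<lambda>s. \<bar>?v s - w s\<bar>)) {0..1}"
    unfolding \<Lambda>_def by (intro has_integral_add has_integral_mult_right integrable_integral wi ei)
  have "h 1 - h 0 \<le> sqrt (1 + k\<^sup>2) * \<Lambda> + integral {0..1} (\<lambda>s. \<bar>?v s - w s\<bar>)"
  proof (rule has_integral_le[OF 1 2])
    fix s :: real assume s: "s \<in> {0..1}"
    have "0 \<le> sqrt (1 + k\<^sup>2) * w s" using wpos[OF s] \<epsilon> by (intro mult_nonneg_nonneg) auto
    then have "0 \<le> sqrt (1 + k\<^sup>2) * w s + \<bar>?v s - w s\<bar>" by simp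
    then show "(if s \<in> N \<union> {0, 1} then 0 else h' s) \<le> sqrt (1 + k\<^sup>2) * w s + \<bar>?v s - w s\<bar>"
      using hbd[of s] s by (simp del: Un_insert_right)
  qed
  \<comment> \<open>Here the proportional rate pays off: horizontal and vertical speed keep a
    constant ratio, so the total is a hypotenuse and not the larger sum of length and |c|.\<close>
  also have "sqrt (1 + k\<^sup>2) * \<Lambda> = sqrt (\<Lambda>\<^sup>2 + c\<^sup>2)"
  proof -
    have "sqrt (1 + k\<^sup>2) * \<Lambda> = sqrt ((1 + k\<^sup>2) * \<Lambda>\<^sup>2)" using \<Lambda> by (simp add: real_sqrt_mult)
    also have "(1 + k\<^sup>2) * \<Lambda>\<^sup>2 = \<Lambda>\<^sup>2 + c\<^sup>2" using \<Lambda> by (simp add: k_def field_simps)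
    finally show ?thesis .
  qed
  also have "sqrt (\<Lambda>\<^sup>2 + c\<^sup>2) \<le> sqrt ((integral {0..1} ?v + \<epsilon>)\<^sup>2 + c\<^sup>2)"
    using \<Lambda> \<Lambda>le by (intro real_sqrt_le_mono add_right_mono power_mono) auto
  finally have "h 1 - h 0 \<le> sqrt ((integral {0..1} ?v + \<epsilon>)\<^sup>2 + c\<^sup>2) + \<epsilon>" using ele by linarith
  moreover have "f 0 = 1" using nx by (simp add: f_def y_def \<theta>01 x_def norm_eq_1)
  moreover have "f 1 = inner (\<gamma> 0) (rot c (\<gamma> 1))" by (simp add: f_def y_def \<theta>01 x_def)
  ultimately show ?thesis by (simp add: h_def)
qed

lemma twisted_length_bound:
  fixes \<gamma> :: "real \<Rightarrow> complex^'m"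
  assumes "horizontal_curve 0 1 \<gamma>"
  shows "arccos (inner (\<gamma> 0) (rot c (\<gamma> 1))) \<le> sqrt ((curve_length 0 1 \<gamma>)\<^sup>2 + c\<^sup>2)"
proof -
  have sph: "norm (\<gamma> s) = 1" if "s \<in> {0..1}" for s
    using assms that by (force simp: horizontal_curve_def)
  obtain K where lip: "K-lipschitz_on {0..1} \<gamma>" using assms by (auto simp: horizontal_curve_def)
  have "AE t in lebesgue. t \<in> {0..1} \<longrightarrow> \<gamma> differentiable (at t) \<and> vector_derivative \<gamma> (at t) \<in> hdist (\<gamma> t)"
    using assms by (simp add: horizontal_curve_def)
  then obtain N where N: "negligible N" and
    ND: "\<And>s. s \<in> {0..1} - N \<Longrightarrow> \<gamma> differentiable (at s) \<and> vector_derivative \<gamma> (at s) \<in> hdist (\<gamma> s)"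
    unfolding eventually_ae_filter_negligible by blast
  have d: "(\<gamma> has_vector_derivative vector_derivative \<gamma> (at s)) (at s)" if "s \<in> {0..1} - N" for s
    using ND[OF that] by (simp add: vector_derivative_works)
  define L where "L = curve_length 0 1 \<gamma>"
  define a where "a = inner (\<gamma> 0) (rot c (\<gamma> 1))"
  have "\<bar>a\<bar> \<le> 1"
    using Cauchy_Schwarz_ineq2[of "\<gamma> 0" "rot c (\<gamma> 1)"] sph[of 0] sph[of 1] by (simp add: a_def)
  \<comment> \<open>One sequence serves both as \<open>\<epsilon>\<close> and as
    \<open>1 - r\<close>. Starting at 1/2 instead of 1 keeps \<open>r\<close> positive already for
    \<open>k = 0\<close>.\<close>
  let ?\<epsilon> = "\<lambda>k. inverse (real (Suc (Suc k)))"
  have \<epsilon>: "?\<epsilon> \<longlonglongrightarrow> 0" using LIMSEQ_inverse_real_of_nat by (rule LIMSEQ_Suc)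
  have \<epsilon>1: "0 < ?\<epsilon> k" "?\<epsilon> k < 1" for k by (simp_all add: field_simps)
  have r1: "\<bar>1 - ?\<epsilon> k\<bar> \<le> 1" for k using \<epsilon>1[of k] by linarith
  have le: "arccos ((1 - ?\<epsilon> k) * a) - arccos (1 - ?\<epsilon> k) \<le> sqrt ((L + ?\<epsilon> k)\<^sup>2 + c\<^sup>2) + ?\<epsilon> k" for k
    using twisted_length_bound_aux[OF lip sph N d conjunct2[OF ND] \<epsilon>1(1)[of k], of "1 - ?\<epsilon> k" c] \<epsilon>1[of k]
    by (simp add: L_def curve_length_def a_def)
  have arc: "(\<lambda>k. arccos (u k)) \<longlonglongrightarrow> arccos l" if "u \<longlonglongrightarrow> l" "\<And>k. \<bar>u k\<bar> \<le> 1" "\<bar>l\<bar> \<le> 1" for u :: "nat \<Rightarrow> real" and l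
    by (rule continuous_on_tendsto_compose[OF continuous_on_arccos' that(1)]) (use that in \<open>auto simp: abs_le_iff minus_le_iff\<close>)
  have t1: "(\<lambda>k. (1 - ?\<epsilon> k) * a) \<longlonglongrightarrow> (1 - 0) * a" "(\<lambda>k. 1 - ?\<epsilon> k) \<longlonglongrightarrow> 1 - 0"
    by (intro tendsto_intros \<epsilon>)+
  have r1a: "\<bar>(1 - ?\<epsilon> k) * a\<bar> \<le> 1" for k
    unfolding abs_mult using mult_mono[OF r1[of k] \<open>\<bar>a\<bar> \<le> 1\<close>] by (simp only: mult_1_left abs_ge_zero zero_le_one)
  have "(\<lambda>k. arccos ((1 - ?\<epsilon> k) * a) - arccos (1 - ?\<epsilon> k)) \<longlonglongrightarrow> arccos ((1 - 0) * a) - arccos (1 - 0)"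
    by (rule tendsto_diff[OF arc[OF t1(1) r1a] arc[OF t1(2) r1]]) (use \<open>\<bar>a\<bar> \<le> 1\<close> in simp_all)
  moreover have "(\<lambda>k. sqrt ((L + ?\<epsilon> k)\<^sup>2 + c\<^sup>2) + ?\<epsilon> k) \<longlonglongrightarrow> sqrt ((L + 0)\<^sup>2 + c\<^sup>2) + 0"
    by (intro tendsto_intros \<epsilon>)
  ultimately have "arccos ((1 - 0) * a) - arccos (1 - 0) \<le> sqrt ((L + 0)\<^sup>2 + c\<^sup>2) + 0"
    by (rule LIMSEQ_le) (use le in blast)
  then show ?thesis by (simp add: a_def L_def)
qed

text \<open>If the speed is not integrable, the integral has the default value 0.\<close>

lemma curve_length_nonneg: "0 \<le> curve_length a b \<gamma>"
  unfolding curve_length_def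
  by (cases "(\<lambda>t. norm (vector_derivative \<gamma> (at t))) integrable_on {a..b}")
    (simp_all add: integral_nonneg not_integrable_integral)

context unit_covector
begin

text \<open>Rotation by \<open>b * t\<close> undoes the fibre rotation in \<open>geo\<close> and
  leaves the great circle through \<open>x\<close>.\<close>

lemma inner_x_rot_geo: "inner x (rot (b * t) (geo x p t)) = cos (\<omega> * t)"
  by (simp add: geo_def rot_rot inner_add_right)

lemma curve_length_ge:
  assumes "horizontal_curve 0 1 \<gamma>" "\<gamma> 0 = x" "\<gamma> 1 = geo x p T"
    and T: "0 \<le> T" "T \<le> pi / \<omega>"
  shows "T \<le> curve_length 0 1 \<gamma>"
proof -
  have wT: "0 \<le> \<omega> * T" "\<omega> * T \<le> pi" using T omega_pos by (auto simp: field_simps)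
  have "\<omega> * T \<le> sqrt ((curve_length 0 1 \<gamma>)\<^sup>2 + (b * T)\<^sup>2)"
    \<comment> \<open>The restriction to T <= pi / \<omega> enters here: arccos inverts cos only on
      [0, pi].\<close>
    using twisted_length_bound[OF assms(1), of "b * T"] wT
    by (simp add: assms(2,3) inner_x_rot_geo arccos_cos)
  then have "(\<omega> * T)\<^sup>2 \<le> (curve_length 0 1 \<gamma>)\<^sup>2 + (b * T)\<^sup>2"
    using wT by (metis real_sqrt_le_iff real_sqrt_abs abs_of_nonneg)
  then have "T\<^sup>2 \<le> (curve_length 0 1 \<gamma>)\<^sup>2"
    by (simp add: power_mult_distrib omega_sq algebra_simps)
  then show ?thesis using curve_length_nonneg by (rule power2_le_imp_le)
qed

end

subsection \<open>Geodesics beyond the cusp\<close>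

definition unit_speed_reach :: "complex^'m \<Rightarrow> complex^'m \<Rightarrow> real \<Rightarrow> bool" where
  "unit_speed_reach y1 y2 L \<longleftrightarrow> 0 \<le> L \<and> (\<exists>\<gamma> g S. \<gamma> 0 = y1 \<and> \<gamma> L = y2 \<and> continuous_on {0..L} \<gamma> \<and>
     (\<forall>t\<in>{0..L}. norm (\<gamma> t) = 1) \<and> finite S \<and>
     (\<forall>t\<in>{0<..<L} - S. (\<gamma> has_vector_derivative g t) (at t) \<and> norm (g t) = 1 \<and> g t \<in> hdist (\<gamma> t)))"

text \<open>Unit speed is demanded only for \<open>0 < L\<close>, since an arc of angle 0 comes out
  as a constant curve with velocity 0.\<close>

lemma unit_speed_reachI:
  assumes "0 \<le> L" and "\<And>t. (\<gamma> has_vector_derivative g t) (at t)" "\<And>t. norm (\<gamma> t) = 1"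
    and "0 < L \<Longrightarrow> (\<And>t. norm (g t) = 1)" "\<And>t. g t \<in> hdist (\<gamma> t)"
  shows "unit_speed_reach (\<gamma> 0) (\<gamma> L) L"
proof -
  have "continuous_on {0..L} \<gamma>"
    using assms(2) by (meson continuous_at_imp_continuous_on has_vector_derivative_continuous)
  then show ?thesis
    unfolding unit_speed_reach_def using assms
    by (intro conjI exI[of _ \<gamma>] exI[of _ g] exI[of _ "{}"]) auto
qed

lemma unit_speed_reach_trans:
  assumes "unit_speed_reach y1 y2 A" "unit_speed_reach y2 y3 B"
  shows "unit_speed_reach y1 y3 (A + B)"
proof -
  obtain \<gamma>1 g1 S1 where A: "0 \<le> A" "\<gamma>1 0 = y1" "\<gamma>1 A = y2" "continuous_on {0..A} \<gamma>1"
    "\<And>t. t \<in> {0..A} \<Longrightarrow> norm (\<gamma>1 t) = 1" "finite S1"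
    "\<And>t. t \<in> {0<..<A} - S1 \<Longrightarrow> (\<gamma>1 has_vector_derivative g1 t) (at t) \<and> norm (g1 t) = 1 \<and> g1 t \<in> hdist (\<gamma>1 t)"
    using assms(1) unfolding unit_speed_reach_def by blast
  obtain \<gamma>2 g2 S2 where B: "0 \<le> B" "\<gamma>2 0 = y2" "\<gamma>2 B = y3" "continuous_on {0..B} \<gamma>2"
    "\<And>t. t \<in> {0..B} \<Longrightarrow> norm (\<gamma>2 t) = 1" "finite S2"
    "\<And>t. t \<in> {0<..<B} - S2 \<Longrightarrow> (\<gamma>2 has_vector_derivative g2 t) (at t) \<and> norm (g2 t) = 1 \<and> g2 t \<in> hdist (\<gamma>2 t)"
    using assms(2) unfolding unit_speed_reach_def by blast
  define \<gamma> where "\<gamma> = (\<lambda>t. if t \<le> A then \<gamma>1 t else \<gamma>2 (t - A))"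
  define g where "g = (\<lambda>t. if t \<le> A then g1 t else g2 (t - A))"
  define S where "S = S1 \<union> (\<lambda>t. t + A) ` S2 \<union> {A}"
  have "continuous_on ({0..A} \<union> {A..A+B}) \<gamma>"
    unfolding \<gamma>_def
  proof (rule continuous_on_If)
    show "continuous_on {A..A+B} (\<lambda>t. \<gamma>2 (t - A))"
      by (rule continuous_on_compose2[OF B(4)]) (auto intro!: continuous_intros)
  qed (use A B in auto)
  then have cont: "continuous_on {0..A+B} \<gamma>"
    using A(1) B(1) by (simp add: ivl_disj_un_two_touch)
  have der: "(\<gamma> has_vector_derivative g t) (at t) \<and> norm (g t) = 1 \<and> g t \<in> hdist (\<gamma> t)"
    if t: "t \<in> {0<..<A+B} - S" for t
  proof (cases "t < A")
    case True
    then have t1: "t \<in> {0<..<A} - S1" using t by (auto simp: S_def)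
    have "(\<gamma> has_vector_derivative g1 t) (at t)"
      by (rule has_vector_derivative_transform_within_open[of \<gamma>1 _ _ "{..<A}"])
        (use True A(7)[OF t1] in \<open>auto simp: \<gamma>_def\<close>)
    then show ?thesis using True A(7)[OF t1] by (simp add: \<gamma>_def g_def)
  next
    case False
    then have tA: "A < t" using t by (cases "t = A") (auto simp: S_def)
    then have t2: "t - A \<in> {0<..<B} - S2" using t by (force simp: S_def image_iff)
    have "((\<lambda>t. t - A) has_vector_derivative 1) (at t)"
      by (auto intro!: derivative_eq_intros)
    from vector_diff_chain_at[OF this conjunct1[OF B(7)[OF t2]]]
    have "((\<lambda>t. \<gamma>2 (t - A)) has_vector_derivative g2 (t - A)) (at t)" by (simp add: o_def)
    then have "(\<gamma> has_vector_derivative g2 (t - A)) (at t)"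
      by (rule has_vector_derivative_transform_within_open[of _ _ _ "{A<..}"])
        (use tA in \<open>auto simp: \<gamma>_def\<close>)
    then show ?thesis using tA B(7)[OF t2] by (simp add: \<gamma>_def g_def)
  qed
  have "\<gamma> 0 = y1" "\<gamma> (A + B) = y3"
    using A(1-3) B(1-3) by (cases "B = 0"; simp add: \<gamma>_def)+
  moreover have "norm (\<gamma> t) = 1" if "t \<in> {0..A+B}" for t
    using that A(5)[of t] B(5)[of "t - A"] by (auto simp: \<gamma>_def)
  moreover have "finite S" using A(6) B(6) by (simp add: S_def)
  ultimately show ?thesis
    unfolding unit_speed_reach_def using A(1) B(1) cont der
    by (intro conjI exI[of _ \<gamma>] exI[of _ g] exI[of _ S] ballI) auto
qed

text \<open>Rescaling to the unit interval gives constant speed \<open>L\<close> off the corners;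
  integrating the velocity across them yields the Lipschitz constant \<open>L\<close>.\<close>

lemma unit_speed_reach_horizontal_curve:
  assumes "unit_speed_reach y1 y2 L" "0 < L"
  shows "\<exists>\<gamma>. horizontal_curve 0 1 \<gamma> \<and> \<gamma> 0 = y1 \<and> \<gamma> 1 = y2 \<and> curve_length 0 1 \<gamma> = L"
proof -
  obtain \<gamma> g S where \<gamma>: "\<gamma> 0 = y1" "\<gamma> L = y2" "continuous_on {0..L} \<gamma>"
    "\<And>t. t \<in> {0..L} \<Longrightarrow> norm (\<gamma> t) = 1" "finite S"
    "\<And>t. t \<in> {0<..<L} - S \<Longrightarrow> (\<gamma> has_vector_derivative g t) (at t) \<and> norm (g t) = 1 \<and> g t \<in> hdist (\<gamma> t)"
    using assms(1) unfolding unit_speed_reach_def by blast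
  define \<delta> where "\<delta> = (\<lambda>s. \<gamma> (L * s))"
  define S' where "S' = (\<lambda>t. t / L) ` S \<union> {0, 1}"
  have S': "finite S'" by (simp add: S'_def \<gamma>(5))
  have Ls: "L * s \<in> {0<..<L} - S" if "s \<in> {0..1} - S'" for s
    using that assms(2) by (force simp: S'_def image_iff less_le)
  have der: "(\<delta> has_vector_derivative L *\<^sub>R g (L * s)) (at s)" if "s \<in> {0..1} - S'" for s
  proof -
    have "((\<lambda>s. L * s) has_vector_derivative L) (at s)"
      by (auto intro!: derivative_eq_intros simp: has_real_derivative_iff_has_vector_derivative[symmetric])
    from vector_diff_chain_at[OF this conjunct1[OF \<gamma>(6)[OF Ls[OF that]]]]
    show ?thesis by (simp add: o_def \<delta>_def)
  qed
  have vd: "vector_derivative \<delta> (at s) = L *\<^sub>R g (L * s)" if "s \<in> {0..1} - S'" for s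
    by (rule vector_derivative_at[OF der[OF that]])
  have cont: "continuous_on {0..1} \<delta>"
    unfolding \<delta>_def using assms(2)
    by (intro continuous_on_compose2[OF \<gamma>(3)]) (auto intro!: continuous_intros mult_left_le)
  have sph: "norm (\<delta> s) = 1" if "s \<in> {0..1}" for s
    unfolding \<delta>_def using that assms(2) by (intro \<gamma>(4)) (auto intro: mult_left_le)
  define D where "D = (\<lambda>s. if s \<in> S' then 0 else L *\<^sub>R g (L * s))"
  have inc: "norm (\<delta> t - \<delta> s) \<le> L * (t - s)" if "s \<le> t" "s \<in> {0..1}" "t \<in> {0..1}" for s t
  proof -
    have "(D has_integral \<delta> t - \<delta> s) {s..t}"
    proof (rule fundamental_theorem_of_calculus_interior_strong[OF S' \<open>s \<le> t\<close>])
      show "continuous_on {s..t} \<delta>" by (rule continuous_on_subset[OF cont]) (use that in auto)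
      fix u assume u: "u \<in> {s<..<t} - S'"
      then show "(\<delta> has_vector_derivative D u) (at u)"
        using der[of u] that by (auto simp: D_def)
    qed
    then have I: "(D has_integral \<delta> t - \<delta> s) (cbox s t)" by simp
    have "norm (D u) \<le> L" if "u \<in> cbox s t" for u
      using \<gamma>(6)[OF Ls[of u]] that \<open>s \<in> {0..1}\<close> \<open>t \<in> {0..1}\<close> assms(2) by (auto simp: D_def)
    from has_integral_bound[OF less_imp_le[OF assms(2)] I this]
    show ?thesis using \<open>s \<le> t\<close> by simp
  qed
  have lip: "L-lipschitz_on {0..1} \<delta>"
  proof (rule lipschitz_onI)
    fix s t :: real assume "s \<in> {0..1}" "t \<in> {0..1}"
    then show "dist (\<delta> s) (\<delta> t) \<le> L * dist s t"
      using inc[of s t] inc[of t s] by (cases "s \<le> t") (auto simp: dist_norm norm_minus_commute)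
  qed (use assms(2) in simp)
  have hd: "L *\<^sub>R g (L * s) \<in> hdist (\<delta> s)" if "s \<in> {0..1} - S'" for s
    using \<gamma>(6)[OF Ls[OF that]] by (simp add: hdist_def \<delta>_def)
  have "horizontal_curve 0 1 \<delta>"
    unfolding horizontal_curve_def
  proof (intro conjI exI)
    show "\<delta> ` {0..1} \<subseteq> sphere 0 1" using sph by auto
    show "L-lipschitz_on {0..1} \<delta>" by (rule lip)
    show "AE t in lebesgue. t \<in> {0..1} \<longrightarrow> \<delta> differentiable (at t) \<and> vector_derivative \<delta> (at t) \<in> hdist (\<delta> t)"
      unfolding eventually_ae_filter_negligible
    proof (intro exI conjI)
      show "negligible S'" by (rule negligible_finite[OF S'])
      show "{t. \<not> (t \<in> {0..1} \<longrightarrow> \<delta> differentiable (at t) \<and> vector_derivative \<delta> (at t) \<in> hdist (\<delta> t))} \<subseteq> S'"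
      proof (rule subsetI, rule ccontr)
        fix t assume "t \<in> {t. \<not> (t \<in> {0..1} \<longrightarrow> \<delta> differentiable (at t) \<and> vector_derivative \<delta> (at t) \<in> hdist (\<delta> t))}"
          and "t \<notin> S'"
        then have "t \<in> {0..1} - S'" and "\<delta> differentiable (at t) \<Longrightarrow> vector_derivative \<delta> (at t) \<notin> hdist (\<delta> t)"
          by auto
        then show False
          using vd[of t] hd[of t] differentiableI_vector[OF der[of t]] by simp
      qed
    qed
  qed simp
  moreover have "curve_length 0 1 \<delta> = L"
  proof -
    have "((\<lambda>s. norm (vector_derivative \<delta> (at s))) has_integral L) {0..1}"
    proof (rule has_integral_spike[OF negligible_finite[OF S']])
      show "((\<lambda>s::real. L) has_integral L) {0..1}" using has_integral_const_real[of L 0 1] by simp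
      show "norm (vector_derivative \<delta> (at s)) = L" if "s \<in> {0..1} - S'" for s
        using \<gamma>(6)[OF Ls[OF that]] assms(2) by (simp add: vd[OF that])
    qed
    then show ?thesis by (simp add: curve_length_def integral_unique)
  qed
  moreover have "\<delta> 0 = y1" "\<delta> 1 = y2" by (simp_all add: \<delta>_def \<gamma>)
  ultimately show ?thesis by blast
qed

lemma sr_dist_le:
  assumes "unit_speed_reach y1 y2 L" "0 < L"
  shows "sr_dist y1 y2 \<le> L"
  unfolding sr_dist_def
proof (rule cInf_lower)
  show "L \<in> {curve_length 0 1 \<gamma> |\<gamma>. horizontal_curve 0 1 \<gamma> \<and> \<gamma> 0 = y1 \<and> \<gamma> 1 = y2}"
    using unit_speed_reach_horizontal_curve[OF assms] by blast
  show "bdd_below {curve_length 0 1 \<gamma> |\<gamma>. horizontal_curve 0 1 \<gamma> \<and> \<gamma> 0 = y1 \<and> \<gamma> 1 = y2}"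
    by (rule bdd_belowI[of _ 0]) (auto simp: curve_length_nonneg)
qed

text \<open>The cusp is the point of the geodesic at time \<open>pi / \<omega>\<close>. The numerator is the angle by which the
  component along the fibre of \<open>x\<close> turns within time \<open>e\<close> of the cusp; going around the cusp at
  distance \<open>sin (\<omega> e) / \<omega>\<close> costs about twice this angle divided by that distance, and the limit shows
  that this is less than \<open>2 e\<close>.\<close>
lemma cusp_angle_small:
  fixes b \<omega> :: real
  assumes "0 < \<omega>"
  shows "((\<lambda>e. (arctan (b * (sin (\<omega> * e) / \<omega>) / cos (\<omega> * e)) - b * e) / (e * (sin (\<omega> * e) / \<omega>))) \<longlongrightarrow> 0) (at_right 0)"
proof -
  \<comment> \<open>The quotient behaves like b e / 3, so the asymptotic expansion needs the sign of
    \<open>b\<close>.\<close>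
  consider "b = 0" | "b > 0" | "b < 0" by linarith
  then show ?thesis
  proof cases
    case 1
    then show ?thesis by simp
  next
    case 2
    with assms show ?thesis by real_asymp
  next
    case 3
    with assms show ?thesis by real_asymp
  qed
qed

text \<open>The curve stays on the torus where the components along \<open>x\<close> and
  \<open>w\<close> have moduli \<open>R\<close> and \<open>s\<close>, at constant distance from the
  fibre of \<open>x\<close>. Horizontality forces the phases to turn in opposite directions at rates
  with R^2 l = s^2 m; then R^2 + s^2 = 1 makes the speed |l| R / s, which explains the
  length.\<close>

lemma unit_speed_reach_arc:
  fixes x w :: "complex^'m"
  assumes "norm x = 1" "norm w = 1" "inner w x = 0" "inner w (hopf_dir x) = 0"
    and R: "0 < R" "0 < s" "R\<^sup>2 + s\<^sup>2 = 1"
  shows "unit_speed_reach (R *\<^sub>R rot \<alpha> x + s *\<^sub>R rot \<beta> w)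
    (R *\<^sub>R rot (\<alpha> + \<theta>) x + s *\<^sub>R rot (\<beta> - \<theta> * R\<^sup>2 / s\<^sup>2) w) (\<bar>\<theta>\<bar> * R / s)"
proof -
  define L where "L = \<bar>\<theta>\<bar> * R / s"
  \<comment> \<open>For nonzero \<open>\<theta>\<close> this is s / R up to sign, the rate of unit
    speed; for \<open>\<theta> = 0\<close> division by zero gives 0.\<close>
  define l where "l = \<theta> / L"
  define m where "m = l * R\<^sup>2 / s\<^sup>2"
  define \<gamma> where "\<gamma> = (\<lambda>t. R *\<^sub>R rot (\<alpha> + l * t) x + s *\<^sub>R rot (\<beta> - m * t) w)"
  define g where "g = (\<lambda>t. R *\<^sub>R rot (\<alpha> + l * t) (l *\<^sub>R hopf_dir x) + s *\<^sub>R rot (\<beta> - m * t) (- m *\<^sub>R hopf_dir w))"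
  have x: "inner x x = 1" "inner w w = 1" using assms by (simp_all add: norm_eq_1)
  have xw: "inner (rot a x) (rot c w) = 0" "inner (rot c w) (rot a x) = 0" for a c
  proof -
    have "inner x w = 0" "inner (hopf_dir x) w = 0" "inner x (hopf_dir w) = 0" "inner (hopf_dir w) x = 0"
      using assms(3,4) by (metis inner_commute inner_hopf_dir_left neg_0_equal_iff_equal)+
    then show "inner (rot a x) (rot c w) = 0" "inner (rot c w) (rot a x) = 0"
      using assms(3,4) by (simp_all add: rot_def inner_add_left inner_add_right)
  qed
  have Jxw: "inner (rot a (hopf_dir x)) (rot c w) = 0" "inner (rot c (hopf_dir w)) (rot a x) = 0"
    "inner (rot a (hopf_dir x)) (rot c (hopf_dir w)) = 0" "inner (rot c (hopf_dir w)) (rot a (hopf_dir x)) = 0" for a c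
    \<comment> \<open>\<open>hopf_dir\<close> is the rotation by pi / 2, so these relations are
      instances of \<open>xw\<close>.\<close>
    using xw[where a="a + pi / 2" and c=c] xw[where a=a and c="c + pi / 2"]
      xw[where a="a + pi / 2" and c="c + pi / 2"]
    by (simp_all flip: rot_rot) (simp_all add: rot_def[of "pi/2"])
  have rJ: "inner (rot a (hopf_dir v)) (rot a v) = 0" for a and v :: "complex^'m"
    by simp
  have L0: "0 \<le> L" using R by (simp add: L_def)
  have lL: "l * L = \<theta>" using R by (simp add: l_def L_def)
  have "unit_speed_reach (\<gamma> 0) (\<gamma> L) L"
  proof (rule unit_speed_reachI[OF L0])
    fix t
    show "(\<gamma> has_vector_derivative g t) (at t)"
      unfolding \<gamma>_def g_def
      by (rule has_vector_derivative_eq_rhs,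
          (rule has_vector_derivative_add bounded_linear.has_vector_derivative[OF bounded_linear_scaleR_right]
             has_vector_derivative_rot has_vector_derivative_const | (rule derivative_eq_intros refl)+)+)
         simp
    have "inner (\<gamma> t) (\<gamma> t) = R\<^sup>2 + s\<^sup>2"
      by (simp add: \<gamma>_def inner_add_left inner_add_right xw x power2_eq_square)
    then show "norm (\<gamma> t) = 1" by (simp add: R norm_eq_1)
    have "inner (g t) (\<gamma> t) = 0"
      by (simp add: \<gamma>_def g_def inner_add_left inner_add_right inner_diff_left rot_scaleR rot_minus Jxw rJ)
    moreover have "inner (g t) (hopf_dir (\<gamma> t)) = R\<^sup>2 * l - m * s\<^sup>2"
      by (simp add: \<gamma>_def g_def inner_add_left inner_add_right inner_diff_left hopf_dir_add hopf_dir_scaleR hopf_dir_rot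
          rot_scaleR rot_minus Jxw x power2_eq_square)
    moreover have "m * s\<^sup>2 = R\<^sup>2 * l" using R by (simp add: m_def)
    ultimately show "g t \<in> hdist (\<gamma> t)" by (simp add: hdist_def)
    have "inner (g t) (g t) = R\<^sup>2 * l\<^sup>2 + s\<^sup>2 * m\<^sup>2"
      by (simp add: g_def inner_diff_left inner_diff_right rot_scaleR rot_minus Jxw x power2_eq_square)
    also have "\<dots> = (l * R / s)\<^sup>2 * (s\<^sup>2 + R\<^sup>2)"
      using R(1,2) by (simp add: m_def field_simps power2_eq_square)
    also have "\<dots> = (l * R / s)\<^sup>2" using R(3) by (simp add: add.commute)
    finally have gg: "inner (g t) (g t) = (l * R / s)\<^sup>2" .
    assume "0 < L"
    then have "\<theta> \<noteq> 0" by (auto simp: L_def)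
    then have "\<bar>l * R / s\<bar> = 1" using R(1,2) by (simp add: l_def L_def abs_mult)
    then have "(l * R / s)\<^sup>2 = 1" by (metis power2_abs one_power2)
    then show "norm (g t) = 1" using gg by (simp add: norm_eq_1)
  qed
  moreover have "m * L = \<theta> * R\<^sup>2 / s\<^sup>2" using lL by (simp add: m_def algebra_simps)
  ultimately show ?thesis by (simp add: \<gamma>_def lL L_def[symmetric])
qed

section \<open>The distance to points of the geodesic before and after the cusp\<close>

context unit_covector
begin

lemma unit_speed_reach_geo:
  assumes "u \<le> v"
  shows "unit_speed_reach (geo x p u) (geo x p v) (v - u)"
proof -
  have "unit_speed_reach (geo x p (u + 0)) (geo x p (u + (v - u))) (v - u)"
  proof (rule unit_speed_reachI[where g="\<lambda>t. geo_vel x p (u + t)"])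
    fix t
    have "((\<lambda>t. u + t) has_vector_derivative 1) (at t)"
      by (auto intro!: derivative_eq_intros)
    from vector_diff_chain_at[OF this geo_has_vector_derivative]
    show "((\<lambda>t. geo x p (u + t)) has_vector_derivative geo_vel x p (u + t)) (at t)" by (simp add: o_def)
  qed (use assms in \<open>simp_all add: norm_geo norm_geo_vel unit_hproj geo_vel_hdist\<close>)
  then show ?thesis by simp
qed

lemma curve_length_geo: "0 \<le> T \<Longrightarrow> curve_length 0 T (geo x p) = T"
  by (simp add: curve_length_def vector_derivative_at[OF geo_has_vector_derivative] norm_geo_vel unit_hproj)

lemma sr_dist_geo:
  assumes "0 < T" "T \<le> pi / \<omega>"
  shows "sr_dist x (geo x p T) = T"
proof (rule antisym)
  have reach: "unit_speed_reach x (geo x p T) T"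
    using unit_speed_reach_geo[of 0 T] assms by simp
  then show "sr_dist x (geo x p T) \<le> T" by (rule sr_dist_le[OF _ assms(1)])
  show "T \<le> sr_dist x (geo x p T)"
    unfolding sr_dist_def
  proof (rule cInf_greatest)
    show "{curve_length 0 1 \<gamma> |\<gamma>. horizontal_curve 0 1 \<gamma> \<and> \<gamma> 0 = x \<and> \<gamma> 1 = geo x p T} \<noteq> {}"
      using unit_speed_reach_horizontal_curve[OF reach assms(1)] by blast
  qed (use curve_length_ge assms in auto)
qed

text \<open>Writing p = p^h + b i x separates the complex line of \<open>x\<close> from that of p^h.
  The moduli of the two components are the \<open>R\<close> and \<open>s\<close> of the detour
  arc.\<close>

lemma geo_split:
  "geo x p t = rot (- (b * t)) (cos (\<omega> * t) *\<^sub>R x + (b * (sin (\<omega> * t) / \<omega>)) *\<^sub>R hopf_dir x)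
     + (sin (\<omega> * t) / \<omega>) *\<^sub>R rot (- (b * t)) (hproj x p)"
proof -
  have p: "p = hproj x p + b *\<^sub>R hopf_dir x" by (simp add: hproj_eq)
  show ?thesis
    unfolding geo_def
    by (subst (4) p) (simp only: rot_add rot_scaleR scaleR_add_right, simp add: ac_simps)
qed

text \<open>The hypotheses say \<open>R exp (\<i> \<eta>) = cos (\<omega> \<epsilon>) + \<i> b s\<close>.\<close>
lemma geo_near_cusp:
  assumes "cos (\<omega> * \<epsilon>) = R * cos \<eta>" "b * s = R * sin \<eta>" "s = sin (\<omega> * \<epsilon>) / \<omega>"
  shows "geo x p (pi / \<omega> + \<epsilon>) = R *\<^sub>R rot (pi - b * pi / \<omega> + (\<eta> - b * \<epsilon>)) x
      + s *\<^sub>R rot (pi - b * pi / \<omega> - b * \<epsilon>) (hproj x p)"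
proof -
  have w: "\<omega> * (pi / \<omega> + \<epsilon>) = \<omega> * \<epsilon> + pi" using omega_pos by (simp add: field_simps)
  have "cos (\<omega> * \<epsilon>) *\<^sub>R x + (b * s) *\<^sub>R hopf_dir x = R *\<^sub>R rot \<eta> x"
    unfolding assms(1,2) by (simp add: rot_def scaleR_add_right)
  note eq = this
  have "cos (\<omega> * (pi / \<omega> + \<epsilon>)) *\<^sub>R x + (b * (sin (\<omega> * (pi / \<omega> + \<epsilon>)) / \<omega>)) *\<^sub>R hopf_dir x = - (R *\<^sub>R rot \<eta> x)"
    unfolding w by (simp add: assms(3) eq[symmetric, unfolded assms(3)])
  moreover have "sin (\<omega> * (pi / \<omega> + \<epsilon>)) / \<omega> = - s" unfolding w by (simp add: assms(3))
  ultimately have "geo x p (pi / \<omega> + \<epsilon>) = rot (- (b * (pi / \<omega> + \<epsilon>))) (rot pi (R *\<^sub>R rot \<eta> x))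
      + s *\<^sub>R rot (- (b * (pi / \<omega> + \<epsilon>))) (rot pi (hproj x p))"
    unfolding geo_split[of "pi / \<omega> + \<epsilon>"] by (simp add: rot_minus)
  also have "\<dots> = R *\<^sub>R rot (pi - b * pi / \<omega> + (\<eta> - b * \<epsilon>)) x
      + s *\<^sub>R rot (pi - b * pi / \<omega> - b * \<epsilon>) (hproj x p)"
    unfolding rot_scaleR rot_rot by (simp add: algebra_simps)
  finally show ?thesis .
qed

text \<open>The covectors reaching the cusp point at the same time as \<open>p\<close>.\<close>
lemma rotated_covector:
  defines "q \<equiv> \<lambda>\<phi>. rot \<phi> (hproj x p) + b *\<^sub>R hopf_dir x"
  shows "unit_covector x (q \<phi>)" "inner (q \<phi>) (hopf_dir x) = b" "norm (q \<phi>) = \<omega>" "hproj x (q \<phi>) = rot \<phi> (hproj x p)"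
proof -
  have w: "inner (hproj x p) x = 0" "inner (hproj x p) (hopf_dir x) = 0" "inner (hproj x p) (hproj x p) = 1"
    using hproj_orth[of x p] unit_hproj by (simp_all add: norm_eq_1)
  have rw: "inner (rot \<phi> (hproj x p)) x = 0" "inner (rot \<phi> (hproj x p)) (hopf_dir x) = 0"
    by (simp_all add: rot_def inner_add_left inner_hopf_dir_left w)
  have qx: "inner (q \<phi>) x = 0" by (simp add: q_def inner_add_left rw)
  show qJ: "inner (q \<phi>) (hopf_dir x) = b" by (simp add: q_def inner_add_left rw)
  show h: "hproj x (q \<phi>) = rot \<phi> (hproj x p)"
    unfolding hproj_unit[OF unit, of "q \<phi>"] qx qJ by (simp add: q_def)
  show "unit_covector x (q \<phi>)"
    by unfold_locales (simp_all add: unit qx h unit_hproj)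
  then interpret q: unit_covector x "q \<phi>" .
  have "(norm (q \<phi>))\<^sup>2 = \<omega>\<^sup>2"
    using q.omega_sq omega_sq qJ by simp
  then show "norm (q \<phi>) = \<omega>" by simp
qed

lemma sr_dist_geo_less:
  assumes T: "pi / \<omega> < T"
  shows "sr_dist x (geo x p T) < T"
proof -
  let ?t = "pi / \<omega>"
  let ?F = "\<lambda>e. (arctan (b * (sin (\<omega> * e) / \<omega>) / cos (\<omega> * e)) - b * e) / (e * (sin (\<omega> * e) / \<omega>))"
  have t0: "0 < ?t" using omega_pos by simp
  have "\<forall>\<^sub>F e in at_right 0. \<bar>?F e\<bar> < 1"
    using tendstoD[OF cusp_angle_small[OF omega_pos, of b], of 1] by (simp add: dist_real_def)
  \<comment> \<open>The three bounds keep cos(\<omega> e) positive, so that arctan gives the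
    argument, and place the points of departure and return after time 0 and before
    \<open>T\<close>.\<close>
  moreover have "\<forall>\<^sub>F e in at_right (0::real). e < min (pi / (2 * \<omega>)) (min ?t (T - ?t))"
    using T omega_pos by (intro eventually_at_rightI[where b="min (pi / (2 * \<omega>)) (min ?t (T - ?t))"]) auto
  moreover have "\<forall>\<^sub>F e in at_right (0::real). 0 < e" by (rule eventually_at_right_less)
  ultimately have "\<forall>\<^sub>F e in at_right 0. \<bar>?F e\<bar> < 1 \<and> e < min (pi / (2 * \<omega>)) (min ?t (T - ?t)) \<and> 0 < e"
    by (intro eventually_conj)
  then obtain \<epsilon> where F: "\<bar>?F \<epsilon>\<bar> < 1" and \<epsilon>: "\<epsilon> < pi / (2 * \<omega>)" "\<epsilon> < ?t" "\<epsilon> < T - ?t" "0 < \<epsilon>"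
    using eventually_happens'[of "at_right (0::real)"] by (auto simp: trivial_limit_at_right_real)
  have we: "0 < \<omega> * \<epsilon>" "\<omega> * \<epsilon> < pi / 2" using \<epsilon> omega_pos by (auto simp: field_simps)
  \<comment> \<open>\<open>R\<close> and \<open>\<eta>\<close> are polar coordinates of c + i b s,
    the coefficient of \<open>x\<close> in \<open>geo_split\<close>.\<close>
  define s c \<eta> R where "s = sin (\<omega> * \<epsilon>) / \<omega>" and "c = cos (\<omega> * \<epsilon>)" and "\<eta> = arctan (b * s / c)" and "R = c / cos \<eta>"
  have c: "0 < c" unfolding c_def by (rule cos_gt_zero) (use we in auto)
  have s: "0 < s" unfolding s_def using we omega_pos pi_gt_zero by (intro divide_pos_pos sin_gt_zero) linarith+
  have ce: "0 < cos \<eta>" unfolding \<eta>_def by (intro cos_gt_zero_pi arctan_lbound arctan_ubound)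
  have R0: "0 < R" using c ce by (simp add: R_def)
  have Rc: "c = R * cos \<eta>" using ce by (simp add: R_def)
  have "tan \<eta> = b * s / c" by (simp add: \<eta>_def tan_arctan)
  then have Rs: "b * s = R * sin \<eta>" using c ce by (simp add: R_def tan_def field_simps)
  have "R\<^sup>2 = c\<^sup>2 + (b * s)\<^sup>2"
    unfolding Rs by (subst Rc) (simp add: power_mult_distrib flip: distrib_left)
  moreover have "c\<^sup>2 + \<omega>\<^sup>2 * s\<^sup>2 = 1" using omega_pos by (simp add: c_def s_def power_divide)
  ultimately have R1: "R\<^sup>2 + s\<^sup>2 = 1" by (simp add: omega_sq power_mult_distrib algebra_simps)
  then have "R\<^sup>2 \<le> 1" using zero_le_power2[of s] by linarith
  then have Rle: "R \<le> 1" using R0 by (simp add: power2_le_iff_abs_le abs_square_le_1)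
  \<comment> \<open>Relative to the cusp, the phase of the \<open>x\<close> component is
    \<open>\<delta>\<close> at time \<open>\<epsilon>\<close> after it and \<open>- \<delta>\<close>
    at time \<open>\<epsilon>\<close> before it, so the arc has to turn it by
    \<open>2 * \<delta>\<close>.\<close>
  define \<delta> where "\<delta> = \<eta> - b * \<epsilon>"
  have "\<bar>\<delta>\<bar> < \<epsilon> * s"
    using F \<epsilon>(4) s unfolding \<delta>_def \<eta>_def s_def[symmetric] c_def[symmetric]
    by (simp add: abs_mult pos_divide_less_eq)
  then have "\<bar>\<delta>\<bar> * R < \<epsilon> * s * 1"
    using Rle R0 \<epsilon> s by (intro mult_less_le_imp_less) auto
  then have small: "\<bar>2 * \<delta>\<bar> * R / s < 2 * \<epsilon>" using s by (simp add: field_simps abs_mult)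
  \<comment> \<open>Chosen so that the phase of p^h at the end of the arc agrees with that of the
    given geodesic modulo 2 pi; the last summand compensates the backward turn of that phase along
    the arc.\<close>
  define \<phi> where "\<phi> = pi - 2 * b * \<epsilon> + 2 * \<delta> * R\<^sup>2 / s\<^sup>2"
  define q where "q = rot \<phi> (hproj x p) + b *\<^sub>R hopf_dir x"
  note q = rotated_covector[of \<phi>, folded q_def]
  interpret q: unit_covector x q by (rule q(1))
  let ?a = "pi - b * pi / \<omega>"
  have before: "geo x q (?t - \<epsilon>) = R *\<^sub>R rot (?a - \<delta>) x + s *\<^sub>R rot (?a + b * \<epsilon> + \<phi> + pi) (hproj x p)"
  proof -
    have "geo x q (?t + - \<epsilon>) = R *\<^sub>R rot (pi - b * pi / \<omega> + (- \<eta> - b * - \<epsilon>)) x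
      + (- s) *\<^sub>R rot (pi - b * pi / \<omega> - b * - \<epsilon>) (hproj x q)"
      \<comment> \<open>Reversing time changes the sign of \<open>\<epsilon>\<close>,
        \<open>\<eta>\<close> and \<open>s\<close> but not of \<open>R\<close>; the sign in front of
        the p^h component is then absorbed as a rotation by pi.\<close>
      using q.geo_near_cusp[of "- \<epsilon>" R "- \<eta>" "- s"] Rc Rs
      unfolding q(2,3) by (simp add: c_def s_def)
    also have "\<dots> = R *\<^sub>R rot (?a - \<delta>) x + s *\<^sub>R rot (?a + b * \<epsilon> + \<phi>) (rot pi (hproj x p))"
      unfolding q(4) by (simp add: \<delta>_def rot_rot rot_minus algebra_simps)
    finally show ?thesis unfolding rot_rot by simp
  qed
  have after: "geo x p (?t + \<epsilon>) = R *\<^sub>R rot (?a - \<delta> + 2 * \<delta>) x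
      + s *\<^sub>R rot (?a + b * \<epsilon> + \<phi> + pi - 2 * \<delta> * R\<^sup>2 / s\<^sup>2) (hproj x p)"
  proof -
    have per: "rot (u + 2 * pi) v = rot u v" for u and v :: "complex^'m" by (simp add: rot_def)
    have phase: "?a + b * \<epsilon> + \<phi> + pi - 2 * \<delta> * R\<^sup>2 / s\<^sup>2 = (?a - b * \<epsilon>) + 2 * pi"
      "?a - \<delta> + 2 * \<delta> = ?a + (\<eta> - b * \<epsilon>)"
      by (simp_all add: \<phi>_def \<delta>_def)
    show ?thesis
      unfolding phase per by (rule geo_near_cusp) (use Rc Rs in \<open>simp_all only: c_def s_def\<close>)
  qed
  have w: "inner (hproj x p) x = 0" "inner (hproj x p) (hopf_dir x) = 0"
    using hproj_orth[of x p] by simp_all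
  have "unit_speed_reach x (geo x q (?t - \<epsilon>)) (?t - \<epsilon>)"
    using q.unit_speed_reach_geo[of 0 "?t - \<epsilon>"] \<epsilon> by simp
  moreover have "unit_speed_reach (geo x q (?t - \<epsilon>)) (geo x p (?t + \<epsilon>)) (\<bar>2 * \<delta>\<bar> * R / s)"
    unfolding before after by (rule unit_speed_reach_arc[OF unit unit_hproj w R0 s R1])
  moreover have "unit_speed_reach (geo x p (?t + \<epsilon>)) (geo x p T) (T - (?t + \<epsilon>))"
    using unit_speed_reach_geo \<epsilon> by simp
  ultimately have reach: "unit_speed_reach x (geo x p T) (?t - \<epsilon> + \<bar>2 * \<delta>\<bar> * R / s + (T - (?t + \<epsilon>)))"
    by (blast intro: unit_speed_reach_trans)
  have "0 \<le> \<bar>2 * \<delta>\<bar> * R / s" using R0 s by simp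
  then have "sr_dist x (geo x p T) \<le> ?t - \<epsilon> + \<bar>2 * \<delta>\<bar> * R / s + (T - (?t + \<epsilon>))"
    using \<epsilon> by (intro sr_dist_le[OF reach]) linarith
  also have "\<dots> < T" using small by linarith
  finally show ?thesis .
qed

lemma minimizing_upto_iff:
  assumes "0 < T"
  shows "minimizing_upto x p T \<longleftrightarrow> T \<le> pi / \<omega>"
proof -
  have "minimizing_upto x p T \<longleftrightarrow> T = sr_dist x (geo x p T)"
    using assms by (simp add: minimizing_upto_def psi_eq_geo curve_length_geo)
  then show ?thesis
    using sr_dist_geo[OF assms] sr_dist_geo_less[of T] by (cases "T \<le> pi / \<omega>") auto
qed

lemma cut_time_eq: "cut_time x p = ereal (pi / \<omega>)"
  unfolding cut_time_def
proof (rule cSup_eq_maximum)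
  show "ereal (pi / \<omega>) \<in> {ereal T |T. T > 0 \<and> minimizing_upto x p T}"
    using omega_pos minimizing_upto_iff[of "pi / \<omega>"] by auto
  show "\<And>t. t \<in> {ereal T |T. T > 0 \<and> minimizing_upto x p T} \<Longrightarrow> t \<le> ereal (pi / \<omega>)"
    using minimizing_upto_iff by auto
qed

end

theorem theorem7p3:
  fixes x p :: "complex^'m"
  assumes "CARD('m) \<ge> 2"
    and "x \<in> sphere 0 1"
    and "p \<in> tspace x"
    and "norm (hproj x p) = 1"
  shows "\<exists>t0. first_conj_time x p t0 \<and> cut_time x p = ereal t0"
proof -
  interpret unit_covector x p
    using assms by unfold_locales (auto simp: tspace_def)
  show ?thesis
    using first_conj_time_pi cut_time_eq by blast
qed

end
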